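(* Let $A\subset\mathbb{R}^d$ be a bounded Lebesgue measurable set. Let $U=(u_1,u_2,\dots)$ be a random sequence of directions chosen independently and uniformly in $S^{d-1}/{\sim}$. Then with probability $1$ the successive random Steiner symmetrizations $A_n=S_{U_n}A=S_{u_n}S_{u_{n-1}}\cdots S_{u_1}A$ converge, with respect to the Nikodym distance, to the ball $B(o,\rho(A))$; that is, almost surely $\lambda_d\big(A_n\bigtriangleup B(o,\rho(A))\big)\to 0$ as $n\to\infty$.
   Context: $\lambda_d$ is $d$-dimensional Lebesgue measure on $\mathbb{R}^d$; $o$ is the origin; $B(q,r)$ is the closed ball with center $q$ and radius $r$; $\kappa_d=\lambda_d(B(o,1))$. For a bounded measurable set $A$, $\rho(A)=(\lambda_d(A)/\kappa_d)^{1/d}$, so $B(o,\rho(A))$ has the same volume as $A$. The Nikodym distance is $d_N(A,B)=\lambda_d(A\bigtriangleup B)$. Steiner symmetral: for a measurable set $A\subset\mathbb{R}^d$ and a unit vector $u$, let $l_u$ be the line through $o$ parallel to $u$ and $u^\perp$ the hyperplane through $o$ orthogonal to $u$. For $x\in u^\perp$ let $c(x)=\emptyset$ if $A\cap(l_u+x)=\emptyset$, and otherwise let $c(x)$ be the (possibly degenerate, possibly infinite) closed segment on $l_u+x$ centered at $x$ whose length is $\lambda^*(A\cap(l_u+x))$, where $\lambda^*$ is one-dimensional outer Lebesgue measure on the line. Then $S_uA=\bigcup_{x\in u^\perp}c(x)$. Note $S_u=S_{-u}$. Directions: $S^{d-1}/{\sim}$ is the unit sphere with $u$ and $-u$ identified,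 with the probability given by normalized surface area restricted to the symmetric Borel sets of $S^{d-1}$ (Borel sets $D$ with $D=-D$). The random sequence $U=(u_1,u_2,\dots)$ is an element of $\Omega=\prod_{n=1}^\infty (S^{d-1}/{\sim})$ with the product probability, and $U_n=(u_1,\dots,u_n)$. *)

theory Defs
  imports "HOL-Probability.Probability"
begin

section \<open>Volume radius and Nikodym distance\<close>

definition volume_radius :: "'a::euclidean_space set \<Rightarrow> real" where
  "volume_radius A =
     root DIM('a) (measure lebesgue A / measure lebesgue (cball 0 1 :: 'a set))"

definition nikodym_dist :: "'a::euclidean_space set \<Rightarrow> 'a set \<Rightarrow> real" where
  "nikodym_dist A B = measure lebesgue ((A - B) \<union> (B - A))"

section \<open>Steiner symmetrization\<close>

text \<open>
  For a unit vector \<open>u\<close> the line \<open>l\<^sub>u + x\<close> is identified with the real line by the isometry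
  \<open>t \<mapsto> x + t u\<close>. The value of the outer measure may be infinite, in which case the segment
  is the whole line; a nonempty null intersection yields the degenerate segment \<open>{x}\<close>.
\<close>

definition line_outer_measure :: "'a::euclidean_space \<Rightarrow> 'a set \<Rightarrow> 'a \<Rightarrow> ennreal" where
  "line_outer_measure u A x = outer_measure_of lebesgue {t::real. x + t *\<^sub>R u \<in> A}"

definition steiner_segment :: "'a::euclidean_space \<Rightarrow> 'a set \<Rightarrow> 'a \<Rightarrow> 'a set" where
  "steiner_segment u A x =
     (if A \<inter> {x + t *\<^sub>R u |t. True} = {} then {}
      else {x + t *\<^sub>R u |t. ennreal (2 * \<bar>t\<bar>) \<le> line_outer_measure u A x})"

definition steiner :: "'a::euclidean_space \<Rightarrow> 'a set \<Rightarrow> 'a set" where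
  "steiner u A = (\<Union>x\<in>{x. x \<bullet> u = 0}. steiner_segment u A x)"

section \<open>Random directions\<close>

text \<open>
  Surface area on the unit sphere: the area of a Borel set \<open>D\<close> is \<open>d\<close> times the volume of the
  cone \<open>{r x | 0 < r \<le> 1, x \<in> D}\<close>, by polar coordinates.
\<close>

definition surface_area :: "'a::euclidean_space measure" where
  "surface_area =
     scale_measure (of_nat DIM('a))
       (distr (restrict_space lborel (cball 0 1 - {0})) (restrict_space borel (sphere 0 1))
          (\<lambda>x. x /\<^sub>R norm x))"

definition antipodal :: "('a::euclidean_space \<times> 'a) set" where
  "antipodal = {(u, v). norm u = 1 \<and> (v = u \<or> v = - u)}"

text \<open>
  Sets \<open>C\<close> of classes \<open>{u, -u}\<close> correspond to symmetric subsets \<open>\<Union>C\<close> of the sphere;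
  the measurable ones are those for which \<open>\<Union>C\<close> is Borel.
\<close>

definition direction_algebra :: "'a::euclidean_space set measure" where
  "direction_algebra =
     sigma (sphere 0 1 // antipodal) {C. C \<subseteq> sphere 0 1 // antipodal \<and> \<Union>C \<in> sets borel}"

definition uniform_direction :: "'a::euclidean_space set measure" where
  "uniform_direction =
     distr (uniform_measure surface_area (sphere 0 1)) direction_algebra (\<lambda>u. antipodal `` {u})"

text \<open>
  Symmetrization in the direction of a class \<open>{u, -u}\<close>; the choice of the representative does not
  matter, see \<open>steiner_direction_class\<close> below.
\<close>

definition steiner_direction :: "'a::euclidean_space set \<Rightarrow> 'a set \<Rightarrow> 'a set" where
  "steiner_direction c A = steiner (SOME u. u \<in> c) A"

text \<open>The sequence \<open>u\<^sub>1, u\<^sub>2, \<dots>\<close> is indexed from 0, that is, \<open>U n\<close> is \<open>u\<^sub>n\<^sub>+\<^sub>1\<close>.\<close>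

primrec steiner_iter :: "(nat \<Rightarrow> 'a::euclidean_space set) \<Rightarrow> 'a set \<Rightarrow> nat \<Rightarrow> 'a set" where
  "steiner_iter U A 0 = A"
| "steiner_iter U A (Suc n) = steiner_direction (U n) (steiner_iter U A n)"

section \<open>Well-definedness\<close>

lemma outer_measure_reflect_le:
  "outer_measure_of lebesgue (uminus ` S) \<le> outer_measure_of lebesgue (S :: real set)"
  unfolding outer_measure_of_def
proof (rule INF_mono)
  fix B :: "real set"
  assume B: "B \<in> {B \<in> sets lebesgue. S \<subseteq> B}"
  have "uminus ` B \<in> sets lebesgue"
    using B differentiable_image_in_sets_lebesgue[of B uminus]
    by (simp add: differentiable_on_minus)
  moreover have "emeasure lebesgue (uminus ` B) = emeasure lebesgue B"
    using emeasure_lebesgue_affine[of "- 1" 0 B] by simp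
  ultimately show "\<exists>C\<in>{B \<in> sets lebesgue. uminus ` S \<subseteq> B}.
      emeasure lebesgue C \<le> emeasure lebesgue B"
    using B by (intro bexI[of _ "uminus ` B"]) auto
qed

lemma outer_measure_reflect:
  "outer_measure_of lebesgue (uminus ` S) = outer_measure_of lebesgue (S :: real set)"
  using outer_measure_reflect_le[of S] outer_measure_reflect_le[of "uminus ` S"]
  by (simp add: image_image)

lemma line_outer_measure_minus: "line_outer_measure (- u) A x = line_outer_measure u A x"
proof -
  have "{t::real. x + t *\<^sub>R (- u) \<in> A} = uminus ` {t. x + t *\<^sub>R u \<in> A}"
  proof (intro set_eqI iffI)
    fix t assume "t \<in> {t::real. x + t *\<^sub>R (- u) \<in> A}"
    then show "t \<in> uminus ` {t. x + t *\<^sub>R u \<in> A}"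
      by (intro image_eqI[of _ _ "- t"]) auto
  qed auto
  then show ?thesis
    by (simp add: line_outer_measure_def outer_measure_reflect)
qed

lemma steiner_segment_minus: "steiner_segment (- u) A x = steiner_segment u A x"
proof -
  have line: "{x + t *\<^sub>R (- u) |t. P \<bar>t\<bar>} = {x + t *\<^sub>R u |t. P \<bar>t\<bar>}" for P
    by (auto; metis abs_minus_cancel scaleR_minus_left minus_minus diff_conv_add_uminus)
  show ?thesis
    unfolding steiner_segment_def line_outer_measure_minus
    using line[of "\<lambda>_. True"] line[of "\<lambda>s. ennreal (2 * s) \<le> line_outer_measure u A x"]
    by simp
qed

lemma steiner_minus: "steiner (- u) A = steiner u A"
  by (simp add: steiner_def steiner_segment_minus)

lemma equiv_antipodal: "equiv (sphere 0 1) antipodal"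
  unfolding antipodal_def equiv_def refl_on_def sym_def trans_def by auto

lemma antipodal_class: "norm u = 1 \<Longrightarrow> antipodal `` {u} = {u, - u}"
  by (auto simp: antipodal_def)

lemma steiner_direction_class:
  assumes "norm u = 1"
  shows "steiner_direction (antipodal `` {u}) A = steiner u A"
proof -
  have "(SOME v. v \<in> {u, - u}) \<in> {u, - u}"
    by (rule someI[of _ u]) simp
  then show ?thesis
    by (auto simp: steiner_direction_def antipodal_class[OF assms] steiner_minus)
qed

lemma Union_quotient_eq:
  assumes "C \<subseteq> sphere 0 1 // antipodal"
  shows "\<Union>C = (\<lambda>u. antipodal `` {u}) -` C \<inter> sphere 0 1"
proof (intro set_eqI iffI)
  fix x assume "x \<in> \<Union>C"
  then obtain c where c: "c \<in> C" "x \<in> c" by auto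
  with assms have "c \<in> sphere 0 1 // antipodal" by auto
  then obtain u where "norm u = 1" "c = {u, - u}"
    by (auto elim!: quotientE simp: antipodal_class)
  then have "norm x = 1" "c = {x, - x}" using c by auto
  with c(1) show "x \<in> (\<lambda>u. antipodal `` {u}) -` C \<inter> sphere 0 1"
    by (simp add: antipodal_class)
next
  fix x assume "x \<in> (\<lambda>u. antipodal `` {u}) -` C \<inter> sphere 0 1"
  then show "x \<in> \<Union>C" by (auto simp: antipodal_class)
qed

lemma space_direction_algebra [simp]:
  "space (direction_algebra :: 'a::euclidean_space set measure) = sphere 0 1 // antipodal"
  by (auto simp: direction_algebra_def intro!: space_measure_of)

lemma sets_direction_algebra:
  "sets (direction_algebra :: 'a::euclidean_space set measure) =
     {C. C \<subseteq> sphere 0 1 // antipodal \<and> \<Union>C \<in> sets borel}"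
    (is "_ = ?S")
proof -
  let ?Q = "sphere (0::'a) 1 // antipodal"
  have "sigma_algebra ?Q ?S"
    unfolding sigma_algebra_iff2
  proof (intro conjI ballI allI impI)
    fix C assume C: "C \<in> ?S"
    have "\<Union>(?Q - C) = sphere 0 1 - \<Union>C"
      using C by (subst (1 2) Union_quotient_eq)
        (auto intro: quotientI)
    then show "?Q - C \<in> ?S" using C by auto
  next
    fix C :: "nat \<Rightarrow> 'a set set" assume C: "range C \<subseteq> ?S"
    have "\<Union>(\<Union>i. C i) = (\<Union>i. \<Union>(C i))" by auto
    also have "\<dots> \<in> sets borel" using C by (intro sets.countable_UN) auto
    finally show "(\<Union>i. C i) \<in> ?S" using C by auto
  qed auto
  then show ?thesis
    by (simp add: direction_algebra_def sigma_algebra.sets_measure_of_eq)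
qed

lemma space_surface_area [simp]:
  "space (surface_area :: 'a::euclidean_space measure) = sphere 0 1"
  by (simp add: surface_area_def space_scale_measure space_restrict_space)

lemma sets_surface_area [simp, measurable_cong]:
  "sets (surface_area :: 'a::euclidean_space measure) = sets (restrict_space borel (sphere 0 1))"
  by (simp add: surface_area_def)

lemma measurable_normalize:
  "(\<lambda>x::'a::euclidean_space. x /\<^sub>R norm x)
     \<in> restrict_space lborel (cball 0 1 - {0}) \<rightarrow>\<^sub>M restrict_space borel (sphere 0 1)"
  by (intro measurable_restrict_space2 measurable_restrict_space1)
    (auto simp: space_restrict_space)

lemma emeasure_surface_area:
  fixes D :: "'a::euclidean_space set"
  assumes "D \<in> sets borel" "D \<subseteq> sphere 0 1"
  shows "emeasure surface_area D =
           of_nat DIM('a) * emeasure lborel {r *\<^sub>R x |r x. 0 < r \<and> r \<le> 1 \<and> x \<in> D}"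
proof -
  have D: "D \<in> sets (restrict_space borel (sphere 0 1))"
    using assms by (auto simp: sets_restrict_space)
  have "(\<lambda>x. x /\<^sub>R norm x) -` D \<inter> (cball 0 1 - {0}) =
          {r *\<^sub>R x |r x. 0 < r \<and> r \<le> 1 \<and> x \<in> D}" (is "?L = ?R")
  proof (intro set_eqI iffI)
    fix y assume "y \<in> ?L"
    then show "y \<in> ?R"
      by (auto intro!: exI[of _ "norm y"] exI[of _ "y /\<^sub>R norm y"])
  next
    fix y assume "y \<in> ?R"
    then obtain r x where "y = r *\<^sub>R x" "0 < r" "r \<le> 1" "x \<in> D" "norm x = 1"
      using assms(2) by auto
    then show "y \<in> ?L" by auto
  qed
  then show ?thesis
    using D assms(2) by (simp add: surface_area_def emeasure_distr[OF measurable_normalize]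
        space_restrict_space)
      (subst emeasure_restrict_space; force)
qed

lemma measurable_antipodal_class:
  "(\<lambda>u. antipodal `` {u}) \<in> restrict_space borel (sphere (0::'a::euclidean_space) 1)
     \<rightarrow>\<^sub>M direction_algebra"
proof (rule measurableI)
  fix C :: "'a set set" assume "C \<in> sets direction_algebra"
  then show "(\<lambda>u. antipodal `` {u}) -` C \<inter> space (restrict_space borel (sphere 0 1))
      \<in> sets (restrict_space borel (sphere 0 1))"
    by (simp add: space_restrict_space sets_direction_algebra sets_restrict_space
        flip: Union_quotient_eq)
      (metis Int_absorb1 Int_lower2 Union_quotient_eq image_eqI)
qed (auto simp: space_restrict_space intro: quotientI)

lemma emeasure_surface_area_sphere:
  "emeasure surface_area (sphere (0::'a::euclidean_space) 1) \<noteq> 0"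
  "emeasure surface_area (sphere (0::'a::euclidean_space) 1) \<noteq> \<infinity>"
proof -
  have "{r *\<^sub>R x |r x. 0 < r \<and> r \<le> 1 \<and> x \<in> sphere (0::'a) 1} = cball 0 1 - {0}"
    (is "?L = ?R")
  proof (intro set_eqI iffI)
    fix y assume "y \<in> ?R"
    then show "y \<in> ?L"
      by (auto intro!: exI[of _ "norm y"] exI[of _ "y /\<^sub>R norm y"])
  qed auto
  moreover have "emeasure lborel (cball (0::'a) 1 - {0}) = ennreal (unit_ball_vol DIM('a))"
    by (subst emeasure_Diff) (auto simp: emeasure_cball)
  ultimately have *: "emeasure surface_area (sphere (0::'a) 1) =
      of_nat DIM('a) * ennreal (unit_ball_vol DIM('a))"
    by (subst emeasure_surface_area) auto
  show "emeasure surface_area (sphere (0::'a) 1) \<noteq> 0"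
    unfolding * using unit_ball_vol_pos[of "real DIM('a)"] by (simp add: ennreal_eq_0_iff not_le)
  show "emeasure surface_area (sphere (0::'a) 1) \<noteq> \<infinity>"
    unfolding * by (simp add: ennreal_mult_eq_top_iff)
qed

lemma emeasure_uniform_direction:
  assumes "C \<in> sets (direction_algebra :: 'a::euclidean_space set measure)"
  shows "emeasure uniform_direction C =
           emeasure surface_area (\<Union>C) / emeasure surface_area (sphere (0::'a) 1)"
proof -
  have C: "C \<subseteq> sphere 0 1 // antipodal" "\<Union>C \<in> sets borel"
    using assms by (auto simp: sets_direction_algebra)
  have sub: "\<Union>C \<subseteq> sphere 0 1" by (simp add: Union_quotient_eq[OF C(1)])
  have "(\<lambda>u. antipodal `` {u}) \<in> uniform_measure surface_area (sphere 0 1) \<rightarrow>\<^sub>M direction_algebra"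
    using measurable_antipodal_class by (simp cong: measurable_cong_sets)
  then have "emeasure uniform_direction C =
      emeasure (uniform_measure surface_area (sphere 0 1)) (\<Union>C)"
    using assms
    by (subst uniform_direction_def, subst emeasure_distr) (simp_all add: Union_quotient_eq[OF C(1)])
  also have "\<dots> = emeasure surface_area (sphere 0 1 \<inter> \<Union>C) / emeasure surface_area (sphere (0::'a) 1)"
    using C(2) sub by (intro emeasure_uniform_measure) (auto simp: sets_restrict_space)
  finally show ?thesis using sub by (simp add: Int_absorb1)
qed

lemma prob_space_uniform_direction:
  "prob_space (uniform_direction :: 'a::euclidean_space set measure)"
proof -
  have "prob_space (uniform_measure surface_area (sphere (0::'a) 1))"
    by (intro prob_space_uniform_measure emeasure_surface_area_sphere)
  moreover have "(\<lambda>u. antipodal `` {u}) \<in> uniform_measure surface_area (sphere (0::'a) 1)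
      \<rightarrow>\<^sub>M direction_algebra"
    using measurable_antipodal_class by (simp cong: measurable_cong_sets)
  ultimately show ?thesis
    unfolding uniform_direction_def by (rule prob_space.prob_space_distr)
qed

end

theory Submission
  imports Defs
begin

text \<open>
  Let \<open>B\<close> be the ball of the same volume as \<open>A\<close>. On a line of direction \<open>u\<close> both \<open>S\<^sub>uA\<close> and \<open>B\<close> are
  segments with the same centre, so symmetrizing reduces the length of \<open>A - B\<close> on the line by the
  minimum of the lengths of \<open>A - B\<close> and \<open>B - A\<close>, which is at least their product divided by \<open>2R\<close>
  if everything lies in the ball of radius \<open>R\<close>. Averaged over the lines and over \<open>u\<close>, this product
  becomes the integral of a constant times \<open>1 / \<bar>x - y\<bar>\<^bsup>d-1\<^esup>\<close> over \<open>(A - B) \<times> (B - A)\<close>. Hence, with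
  \<open>\<delta>(A) = \<lambda>(A - B) = \<lambda>(B - A)\<close>, the mean of \<open>\<delta>(S\<^sub>uA)\<close> is at most \<open>\<delta>(A) - c \<delta>(A)\<^sup>2\<close>. Therefore the
  sum of the \<open>\<delta>(A\<^sub>n)\<^sup>2\<close> has expectation at most \<open>\<delta>(A) / c\<close>, is almost surely finite, and
  \<open>\<delta>(A\<^sub>n)\<close> tends to \<open>0\<close>.
\<close>

section \<open>Lengths on parallel lines\<close>

lemma nn_integral_lborel_translate:
  fixes f :: "'a::euclidean_space \<Rightarrow> ennreal"
  assumes [measurable]: "f \<in> borel_measurable borel"
  shows "(\<integral>\<^sup>+x. f (x + a) \<partial>lborel) = (\<integral>\<^sup>+x. f x \<partial>lborel)"
proof -
  have "(\<integral>\<^sup>+x. f x \<partial>lborel) = (\<integral>\<^sup>+x. f x \<partial>distr lborel borel ((+) a))"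
    by (simp add: lborel_distr_plus)
  also have "\<dots> = (\<integral>\<^sup>+x. f (a + x) \<partial>lborel)"
    by (subst nn_integral_distr) auto
  finally show ?thesis by (simp add: add.commute)
qed

text \<open>The base point ranges over the whole space and not only over the hyperplane orthogonal
  to \<open>u\<close>, so that lengths can be integrated against \<open>lborel\<close>.\<close>

definition line_length :: "'a::euclidean_space \<Rightarrow> 'a set \<Rightarrow> 'a \<Rightarrow> ennreal" where
  "line_length u E x = emeasure lborel {t::real. x + t *\<^sub>R u \<in> E}"

text \<open>
  With the strict inequality the null sections leave no degenerate segments; the set of their base
  points, a projection, need not be measurable.
\<close>

definition steiner_open :: "'a::euclidean_space \<Rightarrow> 'a set \<Rightarrow> 'a set" where
  "steiner_open u E = {x. ennreal (2 * \<bar>x \<bullet> u\<bar>) < line_length u E x}"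

lemma sets_line_section [measurable]:
  fixes E :: "'a::euclidean_space set"
  assumes [measurable]: "E \<in> sets borel"
  shows "{t::real. x + t *\<^sub>R u \<in> E} \<in> sets borel"
proof -
  have "(\<lambda>t::real. x + t *\<^sub>R u) -` E \<inter> space borel \<in> sets borel"
    by (rule measurable_sets[OF _ assms]) measurable
  then show ?thesis by (simp add: vimage_def)
qed

lemma line_length_eq_nn_integral:
  fixes E :: "'a::euclidean_space set"
  assumes [measurable]: "E \<in> sets borel"
  shows "line_length u E x = (\<integral>\<^sup>+t. indicator E (x + t *\<^sub>R u) \<partial>lborel)"
proof -
  have "(\<integral>\<^sup>+t. indicator E (x + t *\<^sub>R u) \<partial>lborel) =
      (\<integral>\<^sup>+t. indicator {t::real. x + t *\<^sub>R u \<in> E} t \<partial>lborel)"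
    by (intro nn_integral_cong) (simp add: indicator_def)
  then show ?thesis by (simp add: line_length_def)
qed

lemma line_length_translate:
  fixes E :: "'a::euclidean_space set"
  assumes [measurable]: "E \<in> sets borel"
  shows "line_length u E (x + s *\<^sub>R u) = line_length u E x"
  using nn_integral_lborel_translate[of "\<lambda>t. indicator E (x + t *\<^sub>R u)" s]
  by (simp add: line_length_eq_nn_integral algebra_simps)

lemma line_length_minus:
  fixes E :: "'a::euclidean_space set"
  assumes [measurable]: "E \<in> sets borel"
  shows "line_length (- u) E x = line_length u E x"
  using nn_integral_real_affine[of "\<lambda>t. indicator E (x + t *\<^sub>R u)" "-1" 0]
  by (simp add: line_length_eq_nn_integral)

lemma line_length_mono:
  fixes F :: "'a::euclidean_space set"
  assumes "E \<subseteq> F" "F \<in> sets borel"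
  shows "line_length u E x \<le> line_length u F x"
  unfolding line_length_def using assms by (intro emeasure_mono) auto

lemma borel_measurable_line_length:
  fixes u :: "'b \<Rightarrow> 'a::euclidean_space"
  assumes [measurable]: "u \<in> borel_measurable M" "x \<in> borel_measurable M"
    "E \<in> sets borel"
  shows "(\<lambda>\<omega>. line_length (u \<omega>) E (x \<omega>)) \<in> borel_measurable M"
  unfolding line_length_eq_nn_integral[OF assms(3)] by measurable

lemma sets_steiner_open [measurable]:
  fixes E :: "'a::euclidean_space set"
  assumes [measurable]: "E \<in> sets borel"
  shows "steiner_open u E \<in> sets borel"
proof -
  note [measurable] = borel_measurable_line_length
  have "{x \<in> space borel. ennreal (2 * \<bar>x \<bullet> u\<bar>) < line_length u E x} \<in> sets borel"
    by measurable
  then show ?thesis by (simp add: steiner_open_def)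
qed

text \<open>
  Fubini's theorem for a slanted direction: the average over \<open>s\<close> of the slabs
  \<open>{x. s \<le> x \<bullet> u \<le> s + 1}\<close> is \<open>1\<close>, and each slab can be shifted along \<open>u\<close>. No rotation is needed.
\<close>

lemma nn_integral_lines:
  fixes f :: "'a::euclidean_space \<Rightarrow> ennreal"
  assumes u: "norm u = 1" and [measurable]: "f \<in> borel_measurable borel"
  shows "(\<integral>\<^sup>+x. f x \<partial>lborel) =
    (\<integral>\<^sup>+x. (\<integral>\<^sup>+t. f (x + t *\<^sub>R u) \<partial>lborel) * indicator {0..1} (x \<bullet> u) \<partial>lborel)"
proof -
  have uu: "u \<bullet> u = 1" using u by (simp add: dot_square_norm)
  have "(\<integral>\<^sup>+s. indicator {0..1} (a - s) \<partial>lborel) = (1::ennreal)" for a :: real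
  proof -
    have "(\<integral>\<^sup>+s. indicator {0..1} (a - s) \<partial>lborel) = (\<integral>\<^sup>+s. indicator {a-1..a} s \<partial>lborel)"
      by (intro nn_integral_cong) (auto simp: indicator_def)
    then show ?thesis by simp
  qed
  then have "(\<integral>\<^sup>+x. f x \<partial>lborel) =
      (\<integral>\<^sup>+x. f x * (\<integral>\<^sup>+s. indicator {0..1} (x \<bullet> u - s) \<partial>lborel) \<partial>lborel)"
    by simp
  also have "\<dots> = (\<integral>\<^sup>+x. (\<integral>\<^sup>+s. f x * indicator {0..1} (x \<bullet> u - s) \<partial>lborel) \<partial>lborel)"
    by (intro nn_integral_cong nn_integral_cmult[symmetric]) measurable
  also have "\<dots> = (\<integral>\<^sup>+s. (\<integral>\<^sup>+x. f x * indicator {0..1} (x \<bullet> u - s) \<partial>lborel) \<partial>lborel)"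
    by (rule lborel_pair.Fubini') measurable
  also have "\<dots> = (\<integral>\<^sup>+s. (\<integral>\<^sup>+x. f (x + s *\<^sub>R u) * indicator {0..1} (x \<bullet> u) \<partial>lborel) \<partial>lborel)"
  proof (rule nn_integral_cong)
    fix s :: real
    show "(\<integral>\<^sup>+x. f x * indicator {0..1} (x \<bullet> u - s) \<partial>lborel) =
       (\<integral>\<^sup>+x. f (x + s *\<^sub>R u) * indicator {0..1} (x \<bullet> u) \<partial>lborel)"
      using nn_integral_lborel_translate[of "\<lambda>x. f x * indicator {0..1} (x \<bullet> u - s)" "s *\<^sub>R u"]
      by (simp add: inner_add_left uu)
  qed
  also have "\<dots> = (\<integral>\<^sup>+x. (\<integral>\<^sup>+s. f (x + s *\<^sub>R u) * indicator {0..1} (x \<bullet> u) \<partial>lborel) \<partial>lborel)"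
    by (rule lborel_pair.Fubini') measurable
  also have "\<dots> = (\<integral>\<^sup>+x. (\<integral>\<^sup>+t. f (x + t *\<^sub>R u) \<partial>lborel) * indicator {0..1} (x \<bullet> u) \<partial>lborel)"
    by (intro nn_integral_cong nn_integral_multc) measurable
  finally show ?thesis .
qed

lemma emeasure_lines:
  fixes E :: "'a::euclidean_space set"
  assumes u: "norm u = 1" and [measurable]: "E \<in> sets borel"
  shows "emeasure lborel E = (\<integral>\<^sup>+x. line_length u E x * indicator {0..1} (x \<bullet> u) \<partial>lborel)"
  using nn_integral_lines[OF u, of "indicator E"] by (simp add: line_length_eq_nn_integral)

text \<open>The length of \<open>F\<close> is constant along each line and can be pulled out of the
  inner integral. Read backwards, this turns a product of two lengths, which is bilinear line by
  line, into an integral over the points of \<open>D\<close>, a form that can be averaged over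
  \<open>u\<close>.\<close>

lemma nn_integral_section_line_length:
  fixes D :: "'a::euclidean_space set"
  assumes u: "norm u = 1" and [measurable]: "D \<in> sets borel" "F \<in> sets borel"
  shows "(\<integral>\<^sup>+x. indicator D x * line_length u F x \<partial>lborel) =
    (\<integral>\<^sup>+x. line_length u D x * line_length u F x * indicator {0..1} (x \<bullet> u) \<partial>lborel)"
proof -
  note [measurable] = borel_measurable_line_length
  show ?thesis
    by (subst nn_integral_lines[OF u])
      (simp_all add: line_length_translate nn_integral_multc line_length_eq_nn_integral[of D])
qed

text \<open>Integrating over \<open>x\<close> before \<open>t\<close> leaves integrals over
  translates of \<open>N\<close>, which vanish.\<close>

lemma AE_line_length_eq_0:
  fixes N :: "'a::euclidean_space set"
  assumes N: "N \<in> null_sets lborel"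
  shows "AE x in lborel. line_length u N x = 0"
proof -
  note [measurable] = borel_measurable_line_length
  have [measurable]: "N \<in> sets borel" using N by auto
  have "(\<integral>\<^sup>+x. line_length u N x \<partial>lborel) =
    (\<integral>\<^sup>+t. (\<integral>\<^sup>+x. indicator N (x + t *\<^sub>R u) \<partial>lborel) \<partial>lborel)"
    unfolding line_length_eq_nn_integral[OF \<open>N \<in> sets borel\<close>]
    by (rule lborel_pair.Fubini') measurable
  also have "\<dots> = 0"
    using N by (subst nn_integral_lborel_translate) (auto simp: null_sets_def)
  finally show ?thesis by (subst (asm) nn_integral_0_iff_AE) measurable
qed

lemma emeasure_centered_segment:
  "emeasure lborel {t::real. ennreal (2 * \<bar>a + t\<bar>) < m} = m"
proof (cases m)
  case (real r)
  have "2 * \<bar>a + t\<bar> < r \<longleftrightarrow> - a - r/2 < t \<and> t < - a + r/2" for t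
    by (auto simp: abs_if)
  then have "{t::real. ennreal (2 * \<bar>a + t\<bar>) < m} = {- a - r/2 <..< - a + r/2}"
    using real by (simp add: ennreal_less_iff set_eq_iff)
  then show ?thesis using real by simp
next
  case top
  then show ?thesis by (simp add: less_top)
qed

text \<open>The base point is not the centre of the segment: in the parameter \<open>t\<close> the
  centre is \<open>- (x \<bullet> u)\<close>.\<close>

lemma steiner_open_section:
  assumes u: "norm u = 1" and [measurable]: "E \<in> sets borel"
  shows "{t. x + t *\<^sub>R u \<in> steiner_open u E} = {t. ennreal (2 * \<bar>x \<bullet> u + t\<bar>) < line_length u E x}"
  using u by (simp add: steiner_open_def line_length_translate inner_add_left dot_square_norm)

lemma line_length_steiner_open:
  assumes u: "norm u = 1" and E: "E \<in> sets borel"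
  shows "line_length u (steiner_open u E) x = line_length u E x"
  by (simp add: line_length_def[of u "steiner_open u E"] steiner_open_section[OF u E] emeasure_centered_segment)

lemma emeasure_steiner_open:
  assumes u: "norm u = 1" and [measurable]: "E \<in> sets borel"
  shows "emeasure lborel (steiner_open u E) = emeasure lborel E"
  by (simp add: emeasure_lines[OF u] line_length_steiner_open[OF u])

section \<open>The decrease in one symmetrization\<close>

lemma cball_section:
  fixes u x :: "'a::euclidean_space"
  assumes u: "norm u = 1" and r: "0 \<le> r"
  obtains "{t::real. x + t *\<^sub>R u \<in> cball 0 r} = {}"
    | h where "0 \<le> h" "h \<le> r" "{t::real. x + t *\<^sub>R u \<in> cball 0 r} = {t. \<bar>x \<bullet> u + t\<bar> \<le> h}"
proof -
  \<comment> \<open>Completing the square in \<open>t\<close> shows that \<open>q\<close> is the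
    squared half-length of the chord; it is negative when the line misses the ball.\<close>
  define q where "q = r\<^sup>2 - (norm x)\<^sup>2 + (x \<bullet> u)\<^sup>2"
  have le: "(x \<bullet> u)\<^sup>2 \<le> (norm x)\<^sup>2"
    using Cauchy_Schwarz_ineq[of x u] u by (simp add: dot_square_norm)
  have "norm (x + t *\<^sub>R u) \<le> r \<longleftrightarrow> (x \<bullet> u + t)\<^sup>2 \<le> q" for t
  proof -
    have "(norm (x + t *\<^sub>R u))\<^sup>2 = (norm x)\<^sup>2 + 2 * t * (x \<bullet> u) + t\<^sup>2"
      using u unfolding power2_norm_eq_inner norm_eq_1
      by (simp add: inner_add inner_commute[of u x] power2_eq_square algebra_simps)
    moreover have "norm (x + t *\<^sub>R u) \<le> r \<longleftrightarrow> (norm (x + t *\<^sub>R u))\<^sup>2 \<le> r\<^sup>2"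
      using r by (simp add: abs_le_square_iff[symmetric])
    ultimately show ?thesis by (auto simp: q_def power2_sum algebra_simps)
  qed
  then have eq: "{t::real. x + t *\<^sub>R u \<in> cball 0 r} = {t. (x \<bullet> u + t)\<^sup>2 \<le> q}"
    by simp
  show ?thesis
  proof (cases "0 \<le> q")
    case True
    have "(x \<bullet> u + t)\<^sup>2 \<le> q \<longleftrightarrow> \<bar>x \<bullet> u + t\<bar> \<le> sqrt q" for t
      using True by (metis real_sqrt_abs real_sqrt_le_iff)
    moreover have "sqrt q \<le> r" using le r by (intro real_le_lsqrt) (auto simp: q_def)
    ultimately show ?thesis using True eq by (intro that(2)[of "sqrt q"]) auto
  next
    case False
    then have "{t. (x \<bullet> u + t)\<^sup>2 \<le> q} = {}" by (auto simp: not_le intro: less_le_trans)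
    then show ?thesis using eq that(1) by simp
  qed
qed

lemma emeasure_lborel_abs_le:
  assumes "0 \<le> h"
  shows "emeasure lborel {t::real. \<bar>a + t\<bar> \<le> h} = ennreal (2 * h)"
proof -
  have "{t::real. \<bar>a + t\<bar> \<le> h} = {- a - h .. - a + h}" by auto
  then show ?thesis using assms by simp
qed

lemma line_length_cball_le:
  assumes "norm u = 1" "0 \<le> R" "E \<subseteq> cball 0 R"
  shows "line_length u E x \<le> ennreal (2 * R)"
proof -
  have "line_length u (cball 0 R) x \<le> ennreal (2 * R)"
    by (rule cball_section[OF assms(1,2), of x])
      (auto simp: line_length_def emeasure_lborel_abs_le)
  then show ?thesis using line_length_mono[OF assms(3), of u x] by auto
qed

text \<open>For \<open>x\<close> in the symmetral, the ball cuts the line through \<open>x\<close>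
  in a centred segment longer than \<open>2 * \<bar>x \<bullet> u\<bar>\<close>, and such a segment
  contains \<open>x\<close>.\<close>

lemma steiner_open_subset_cball:
  assumes u: "norm u = 1" and R: "0 \<le> R" and E: "E \<subseteq> cball 0 R"
  shows "steiner_open u E \<subseteq> cball 0 R"
proof
  fix x assume "x \<in> steiner_open u E"
  then have *: "ennreal (2 * \<bar>x \<bullet> u\<bar>) < line_length u (cball 0 R) x"
    using line_length_mono[OF E, of u x] by (auto simp: steiner_open_def intro: less_le_trans)
  then have "0 \<in> {t. x + t *\<^sub>R u \<in> cball 0 R}"
    by (cases rule: cball_section[OF u R, of x])
      (auto simp: line_length_def emeasure_lborel_abs_le ennreal_less_iff)
  then show "x \<in> cball 0 R" by simp
qed

text \<open>In passing from \<open>E\<close> to \<open>S\<close>, the excess over \<open>B\<close>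
  drops by the measure of \<open>E - B\<close> if \<open>S\<close> lies in \<open>B\<close>, and by
  that of \<open>B - E\<close> if \<open>S\<close> contains \<open>B\<close>. As both measures are
  at most \<open>c\<close>, the drop is at least their product divided by \<open>c\<close>. Writing
  this with sums and products avoids truncated subtraction in \<open>ennreal\<close>.\<close>

lemma emeasure_nested_diff_le:
  assumes [measurable]: "S \<in> sets M" "B \<in> sets M" "E \<in> sets M"
    and nested: "S \<subseteq> B \<or> B \<subseteq> S" and eq: "emeasure M S = emeasure M E"
    and fin: "emeasure M B \<noteq> \<infinity>"
    and D: "emeasure M (E - B) \<le> c" and F: "emeasure M (B - E) \<le> c"
  shows "c * emeasure M (S - B) + emeasure M (E - B) * emeasure M (B - E) \<le> c * emeasure M (E - B)"
  using nested
proof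
  assume "S \<subseteq> B"
  then have "S - B = {}" by auto
  then have "c * emeasure M (S - B) + emeasure M (E - B) * emeasure M (B - E) =
      emeasure M (E - B) * emeasure M (B - E)"
    by (simp only: emeasure_empty mult_zero_right add_0)
  also have "\<dots> \<le> emeasure M (E - B) * c" using F by (rule mult_left_mono) simp
  finally show ?thesis by (simp only: mult.commute)
next
  assume BS: "B \<subseteq> S"
  have 1: "emeasure M (S - B) + emeasure M B = emeasure M E"
    using emeasure_Un[of B M "S - B"] BS eq by (subst plus_emeasure) (auto simp: Un_absorb2)
  have "emeasure M E + emeasure M (B - E) = emeasure M (E \<union> B)"
    by (subst plus_emeasure) auto
  also have "\<dots> = emeasure M B + emeasure M (E - B)"
    by (subst plus_emeasure) (auto simp: Un_commute)
  finally have "emeasure M B + (emeasure M (S - B) + emeasure M (B - E)) = emeasure M B + emeasure M (E - B)"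
    unfolding 1[symmetric] by (simp only: ac_simps)
  then have 3: "emeasure M (E - B) = emeasure M (S - B) + emeasure M (B - E)"
    using fin by (simp only: ennreal_add_left_cancel) auto
  have "emeasure M (E - B) * emeasure M (B - E) \<le> c * emeasure M (B - E)"
    using D by (rule mult_right_mono) simp
  then have "c * emeasure M (S - B) + emeasure M (E - B) * emeasure M (B - E) \<le>
      c * emeasure M (S - B) + c * emeasure M (B - E)"
    by (rule add_left_mono)
  also have "\<dots> = c * emeasure M (E - B)" by (simp only: 3 distrib_left)
  finally show ?thesis .
qed

lemma line_length_steiner_open_diff_cball:
  assumes u: "norm u = 1" and r: "0 \<le> r" "r \<le> R"
    and [measurable]: "E \<in> sets borel" and E: "E \<subseteq> cball 0 R"
  shows "ennreal (2 * R) * line_length u (steiner_open u E - cball 0 r) x +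
      line_length u (E - cball 0 r) x * line_length u (cball 0 r - E) x
    \<le> ennreal (2 * R) * line_length u (E - cball 0 r) x"
proof -
  define S B L where "S = {t. x + t *\<^sub>R u \<in> steiner_open u E}"
    and "B = {t. x + t *\<^sub>R u \<in> cball 0 r}" and "L = {t. x + t *\<^sub>R u \<in> E}"
  have [measurable]: "S \<in> sets borel" "B \<in> sets borel" "L \<in> sets borel"
    unfolding S_def B_def L_def by auto
  have diff: "line_length u (steiner_open u E - cball 0 r) x = emeasure lborel (S - B)"
    "line_length u (E - cball 0 r) x = emeasure lborel (L - B)"
    "line_length u (cball 0 r - E) x = emeasure lborel (B - L)"
    by (auto simp: line_length_def S_def B_def L_def intro!: arg_cong[where f="emeasure lborel"])
  have S: "S = {t. ennreal (2 * \<bar>x \<bullet> u + t\<bar>) < line_length u E x}"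
    unfolding S_def by (rule steiner_open_section) fact+
  \<comment> \<open>If the line misses the ball, \<open>B\<close> is empty. Otherwise both sections
    are centred at \<open>- (x \<bullet> u)\<close>, and the shorter one lies in the longer.\<close>
  have "S \<subseteq> B \<or> B \<subseteq> S"
    using cball_section[OF u r(1), of x]
  proof cases
    case (2 h)
    then have B: "B = {t. \<bar>x \<bullet> u + t\<bar> \<le> h}" by (simp add: B_def)
    show ?thesis
    proof (cases "line_length u E x \<le> ennreal (2 * h)")
      case True
      have "\<bar>x \<bullet> u + t\<bar> \<le> h" if "ennreal (2 * \<bar>x \<bullet> u + t\<bar>) < line_length u E x" for t
        using less_le_trans[OF that True] by (simp add: ennreal_less_iff)
      then show ?thesis unfolding S B by blast
    next
      case False
      have "ennreal (2 * \<bar>x \<bullet> u + t\<bar>) < line_length u E x" if "\<bar>x \<bullet> u + t\<bar> \<le> h" for t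
      proof -
        have "ennreal (2 * \<bar>x \<bullet> u + t\<bar>) \<le> ennreal (2 * h)" using that by (intro ennreal_leI) simp
        then show ?thesis using False by simp
      qed
      then show ?thesis unfolding S B by blast
    qed
  qed (simp add: B_def)
  moreover have "emeasure lborel S = emeasure lborel L"
    using line_length_steiner_open[OF u \<open>E \<in> sets borel\<close>, of x] by (simp add: line_length_def S_def L_def)
  moreover have "emeasure lborel B \<noteq> \<infinity>"
    using line_length_cball_le[OF u r(1) order_refl, of x] by (auto simp: line_length_def B_def top_unique)
  moreover have "emeasure lborel (L - B) \<le> ennreal (2 * R)"
    unfolding diff[symmetric] using r E by (intro line_length_cball_le[OF u]) auto
  moreover have "emeasure lborel (B - L) \<le> ennreal (2 * R)"
    unfolding diff[symmetric] using r by (intro line_length_cball_le[OF u]) auto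
  ultimately show ?thesis
    unfolding diff by (intro emeasure_nested_diff_le) auto
qed

section \<open>Borel representatives\<close>

text \<open>\<open>E \<union> N\<close> covers \<open>S\<close>; conversely, adding \<open>N\<close>
  to any cover of \<open>S\<close> gives a cover of \<open>E\<close> of the same measure.\<close>

lemma outer_measure_of_lebesgue_null_diff:
  fixes E :: "'a::euclidean_space set"
  assumes E: "E \<in> sets borel" and N: "N \<in> null_sets lborel" and sub: "(S - E) \<union> (E - S) \<subseteq> N"
  shows "outer_measure_of lebesgue S = emeasure lborel E"
proof (rule antisym)
  have N': "N \<in> null_sets lebesgue" using N by (rule null_sets_completionI)
  have "outer_measure_of lebesgue S \<le> emeasure lebesgue (E \<union> N)"
    unfolding outer_measure_of_def using E N sub by (intro INF_lower) auto
  also have "\<dots> = emeasure lebesgue E"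
    using E N' by (intro emeasure_Un_null_set) auto
  also have "\<dots> = emeasure lborel E" using E by simp
  finally show "outer_measure_of lebesgue S \<le> emeasure lborel E" .
  show "emeasure lborel E \<le> outer_measure_of lebesgue S"
    unfolding outer_measure_of_def
  proof (rule INF_greatest)
    fix B assume B: "B \<in> {B \<in> sets lebesgue. S \<subseteq> B}"
    have "emeasure lebesgue E \<le> emeasure lebesgue (B \<union> N)"
      using B N' sub by (intro emeasure_mono) auto
    also have "\<dots> = emeasure lebesgue B"
      using B N' by (simp add: emeasure_Un_null_set)
    finally show "emeasure lborel E \<le> emeasure lebesgue B" using E by simp
  qed
qed

text \<open>The segment through \<open>x\<close> has as its centre the orthogonal projection of
  \<open>x\<close>, and \<open>x\<close> has parameter \<open>x \<bullet> u\<close> on it. This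
  makes the symmetral comparable with \<open>steiner_open\<close> point by point.\<close>

lemma mem_steiner_iff:
  fixes x :: "'a::euclidean_space"
  assumes u: "norm u = 1"
  shows "x \<in> steiner u A \<longleftrightarrow> (\<exists>t. x + t *\<^sub>R u \<in> A) \<and>
    ennreal (2 * \<bar>x \<bullet> u\<bar>) \<le> line_outer_measure u A (x - (x \<bullet> u) *\<^sub>R u)" (is "?L \<longleftrightarrow> ?R")
proof -
  have uu: "u \<bullet> u = 1" using u by (simp add: norm_eq_1)
  show ?thesis
  proof
    assume ?L
    then obtain y s t where y: "y \<bullet> u = 0" "y + s *\<^sub>R u \<in> A" "x = y + t *\<^sub>R u"
      "ennreal (2 * \<bar>t\<bar>) \<le> line_outer_measure u A y"
      by (auto simp: steiner_def steiner_segment_def split: if_splits)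
    have "x \<bullet> u = t" using y uu by (simp add: inner_add_left)
    moreover have "x + (s - t) *\<^sub>R u \<in> A" using y by (simp add: algebra_simps)
    ultimately show ?R using y by auto
  next
    assume R: ?R
    let ?y = "x - (x \<bullet> u) *\<^sub>R u"
    obtain t where t: "x + t *\<^sub>R u \<in> A" using R by auto
    have "?y + (x \<bullet> u + t) *\<^sub>R u \<in> A" using t by (simp add: algebra_simps)
    then have "A \<inter> {?y + t *\<^sub>R u |t. True} \<noteq> {}" by blast
    moreover have "x = ?y + (x \<bullet> u) *\<^sub>R u" by simp
    ultimately have "x \<in> steiner_segment u A ?y"
      using R unfolding steiner_segment_def by auto
    moreover have "?y \<bullet> u = 0" using uu by (simp add: inner_diff_left)
    ultimately show ?L unfolding steiner_def by blast
  qed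
qed

text \<open>This is the difference between closed and open segments: at most two points on each
  line, and none if the length is infinite.\<close>

lemma null_sets_segment_endpoints:
  fixes E :: "'a::euclidean_space set"
  assumes u: "norm u = 1" and [measurable]: "E \<in> sets borel"
  shows "{x. ennreal (2 * \<bar>x \<bullet> u\<bar>) = line_length u E x} \<in> null_sets lborel" (is "?C \<in> _")
proof -
  note [measurable] = borel_measurable_line_length
  have "{x \<in> space borel. ennreal (2 * \<bar>x \<bullet> u\<bar>) = line_length u E x} \<in> sets borel"
    by measurable
  then have C: "?C \<in> sets borel" by simp
  have "line_length u ?C x = 0" for x
  proof -
    have "{t. x + t *\<^sub>R u \<in> ?C} = {t. ennreal (2 * \<bar>x \<bullet> u + t\<bar>) = line_length u E x}"
      using u by (simp add: line_length_translate inner_add_left dot_square_norm)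
    also have "finite \<dots>"
    proof (cases "line_length u E x")
      case (real m)
      have "{t. ennreal (2 * \<bar>x \<bullet> u + t\<bar>) = line_length u E x} \<subseteq> {- (x \<bullet> u) - m / 2, - (x \<bullet> u) + m / 2}"
      proof
        fix t assume "t \<in> {t. ennreal (2 * \<bar>x \<bullet> u + t\<bar>) = line_length u E x}"
        then have "2 * \<bar>x \<bullet> u + t\<bar> = m" using real by simp
        then show "t \<in> {- (x \<bullet> u) - m / 2, - (x \<bullet> u) + m / 2}"
          by (cases "0 \<le> x \<bullet> u + t") auto
      qed
      then show ?thesis by (rule finite_subset) simp
    qed simp
    finally show ?thesis
      unfolding line_length_def by (rule emeasure_lborel_countable[OF countable_finite])
  qed
  then show ?thesis using C by (auto simp: emeasure_lines[OF u C])
qed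

text \<open>On almost every line the sections of \<open>A\<close> and \<open>E\<close> differ by a
  null set and have the same outer measure. The exceptional set consists of the segment endpoints
  and of the lines that \<open>N\<close> meets in positive length.\<close>

lemma steiner_null_diff:
  fixes A :: "'a::euclidean_space set"
  assumes u: "norm u = 1" and E[measurable]: "E \<in> sets borel"
    and N: "N \<in> null_sets lborel" and sub: "(A - E) \<union> (E - A) \<subseteq> N"
  obtains N' where "N' \<in> null_sets lborel"
    "(steiner u A - steiner_open u E) \<union> (steiner_open u E - steiner u A) \<subseteq> N'"
proof
  note [measurable] = borel_measurable_line_length
  have [measurable]: "N \<in> sets borel" using N by auto
  let ?C = "{x. ennreal (2 * \<bar>x \<bullet> u\<bar>) = line_length u E x}"
  let ?Z = "{x. line_length u N x \<noteq> 0}"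
  have "{x \<in> space lborel. line_length u N x \<noteq> 0} \<in> null_sets lborel"
    using AE_line_length_eq_0[OF N, of u] by (subst (asm) AE_iff_null) auto
  then show "?C \<union> ?Z \<in> null_sets lborel"
    using null_sets_segment_endpoints[OF u E] by auto
  have "x \<in> steiner u A \<longleftrightarrow> x \<in> steiner_open u E" if x: "x \<notin> ?C \<union> ?Z" for x
  proof -
    let ?y = "x - (x \<bullet> u) *\<^sub>R u"
    have eq: "line_length u G ?y = line_length u G x" if "G \<in> sets borel" for G
      using line_length_translate[OF that, of u x "- (x \<bullet> u)"] by simp
    have "{t. ?y + t *\<^sub>R u \<in> N} \<in> null_sets lborel"
      using x eq[of N] by (auto simp: line_length_def null_sets_def)
    then have "line_outer_measure u A ?y = emeasure lborel {t. ?y + t *\<^sub>R u \<in> E}"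
      unfolding line_outer_measure_def using sub
      by (intro outer_measure_of_lebesgue_null_diff) auto
    also have "\<dots> = line_length u E x"
      using eq[of E] by (simp add: line_length_def)
    finally have *: "line_outer_measure u A ?y = line_length u E x" .
    \<comment> \<open>A line that misses \<open>A\<close> carries no segment of
      \<open>steiner u A\<close>. There \<open>E\<close> is contained in \<open>N\<close>, so
      \<open>steiner_open\<close> has no point on it either.\<close>
    have "line_length u E x = 0" if "\<nexists>t. x + t *\<^sub>R u \<in> A"
    proof -
      have "{t. x + t *\<^sub>R u \<in> E} \<subseteq> {t. x + t *\<^sub>R u \<in> N}" using that sub by auto
      then have "line_length u E x \<le> line_length u N x"
        unfolding line_length_def by (intro emeasure_mono) auto
      then show ?thesis using x by simp
    qed
    then show ?thesis
      using x unfolding mem_steiner_iff[OF u] *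
      by (cases "\<exists>t. x + t *\<^sub>R u \<in> A") (auto simp: steiner_open_def order_le_less)
  qed
  then show "(steiner u A - steiner_open u E) \<union> (steiner_open u E - steiner u A) \<subseteq> ?C \<union> ?Z"
    by blast
qed

section \<open>Averages over directions\<close>

text \<open>A fixed unit vector that breaks the symmetry between \<open>u\<close> and
  \<open>- u\<close>: its open hemisphere contains one element of every class off the
  equator.\<close>

definition pole :: "'a::euclidean_space" where
  "pole = (SOME b. b \<in> Basis)"

lemma norm_pole: "norm (pole :: 'a::euclidean_space) = 1"
  unfolding pole_def using SOME_Basis by (rule norm_Basis)

text \<open>
  A choice of representatives that is measurable, unlike \<open>SOME\<close>. The value for the null set of
  classes on the equator does not belong to the class.
\<close>

definition direction_rep :: "'a::euclidean_space set \<Rightarrow> 'a" where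
  "direction_rep c = (if \<exists>u\<in>c. 0 < u \<bullet> pole then THE u. u \<in> c \<and> 0 < u \<bullet> pole else pole)"

lemma direction_rep_class:
  fixes u :: "'a::euclidean_space"
  assumes "norm u = 1"
  shows "direction_rep (antipodal `` {u}) =
    (if 0 < u \<bullet> pole then u else if u \<bullet> pole < 0 then - u else pole)"
  unfolding direction_rep_def antipodal_class[OF assms] by (auto intro!: the_equality)

lemma norm_direction_rep:
  assumes "c \<in> sphere (0::'a::euclidean_space) 1 // antipodal"
  shows "norm (direction_rep c) = 1"
  using assms by (auto elim!: quotientE simp: direction_rep_class norm_pole)

lemma measurable_direction_rep [measurable]: "direction_rep \<in> borel_measurable (direction_algebra :: 'a::euclidean_space set measure)"
proof (rule measurableI)
  fix B :: "'a set" assume [measurable]: "B \<in> sets borel"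
  let ?C = "direction_rep -` B \<inter> sphere (0::'a) 1 // antipodal"
  \<comment> \<open>A set of classes is measurable when its union is Borel, so the preimage is
    described by unit vectors; on these the representative is given by the sign of
    \<open>u \<bullet> pole\<close>.\<close>
  have "\<Union>?C = (\<lambda>u. antipodal `` {u}) -` ?C \<inter> sphere 0 1"
    by (rule Union_quotient_eq) auto
  then have "u \<in> \<Union>?C \<longleftrightarrow> norm u = 1 \<and>
      (if 0 < u \<bullet> pole then u else if u \<bullet> pole < 0 then - u else pole) \<in> B" for u
    by (cases "norm u = 1") (simp_all add: direction_rep_class quotientI del: if_split)
  then have "\<Union>?C = {u \<in> space borel. norm u = 1 \<and>
      (if 0 < u \<bullet> pole then u else if u \<bullet> pole < 0 then - u else pole) \<in> B}"
    by (simp add: set_eq_iff)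
  also have "\<dots> \<in> sets borel" by measurable
  finally show "direction_rep -` B \<inter> space direction_algebra \<in> sets direction_algebra"
    by (auto simp: sets_direction_algebra)
qed simp

lemma null_sets_hyperplane:
  assumes u: "norm (u::'a::euclidean_space) = 1"
  shows "{x. x \<bullet> u = 0} \<in> null_sets lborel"
proof -
  have H: "{x. x \<bullet> u = 0} \<in> sets borel"
    using measurable_sets[of "\<lambda>x. x \<bullet> u" borel borel "{0}"] by (simp add: vimage_def)
  have "{t. x + t *\<^sub>R u \<in> {x. x \<bullet> u = 0}} = {- (x \<bullet> u)}" for x
    using u by (auto simp: inner_add_left dot_square_norm)
  then show ?thesis
    using H by (auto simp: emeasure_lines[OF u H] line_length_def)
qed

lemma uniform_direction_class_measurable:
  "(\<lambda>u. antipodal `` {u}) \<in> uniform_measure surface_area (sphere (0::'a::euclidean_space) 1)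
     \<rightarrow>\<^sub>M direction_algebra"
  using measurable_antipodal_class by (simp cong: measurable_cong_sets)

text \<open>The representative fails to lie in its class at most on the equator, and the cone over
  the equator lies in a hyperplane, which is null.\<close>

lemma AE_direction_rep_mem: "AE c in (uniform_direction :: 'a::euclidean_space set measure). direction_rep c \<in> c"
proof -
  let ?Q = "sphere (0::'a) 1 // antipodal"
  let ?C = "{c \<in> ?Q. \<forall>u\<in>c. u \<bullet> pole = 0}"
  have "\<Union>?C = (\<lambda>u. antipodal `` {u}) -` ?C \<inter> sphere 0 1"
    by (rule Union_quotient_eq) auto
  moreover have "antipodal `` {u} \<in> ?C \<longleftrightarrow> u \<bullet> pole = 0" if "norm u = 1" for u
    using quotientI[of u "sphere 0 1" antipodal] that by (auto simp: antipodal_class)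
  ultimately have "\<Union>?C = {u \<in> space borel. norm u = 1 \<and> u \<bullet> pole = 0}"
    by auto
  moreover have "\<dots> \<in> sets borel" by measurable
  ultimately have C: "?C \<in> sets direction_algebra" and
    U: "\<Union>?C \<in> sets borel" "\<Union>?C = {u. norm u = 1 \<and> u \<bullet> pole = 0}"
    by (auto simp: sets_direction_algebra)
  have "{r *\<^sub>R x |r x. 0 < r \<and> r \<le> 1 \<and> x \<in> \<Union>?C} \<subseteq> {x. x \<bullet> pole = 0}"
    unfolding U(2) by auto
  then have "emeasure lborel {r *\<^sub>R x |r x. 0 < r \<and> r \<le> 1 \<and> x \<in> \<Union>?C} = 0"
    using null_sets_hyperplane[OF norm_pole, where 'a='a] by (metis (no_types, lifting) emeasure_eq_0 null_setsD1 null_setsD2)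
  then have "emeasure surface_area (\<Union>?C) = 0"
    using U by (subst emeasure_surface_area) auto
  then have "emeasure uniform_direction ?C = 0"
    by (simp add: emeasure_uniform_direction[OF C])
  then have "?C \<in> null_sets uniform_direction"
    using C by (auto simp: uniform_direction_def)
  moreover have "direction_rep c \<in> c" if c: "c \<in> ?Q - ?C" for c
  proof -
    obtain x where x: "norm x = 1" "c = antipodal `` {x}"
      using c by (auto elim!: quotientE)
    moreover have "x \<bullet> pole \<noteq> 0"
      using c unfolding x(2) antipodal_class[OF x(1)] by auto
    ultimately show ?thesis
      by (simp add: direction_rep_class) (simp add: antipodal_def)
  qed
  ultimately show ?thesis
    by (intro AE_I'[of ?C]) (auto simp: uniform_direction_def)
qed

text \<open>Surface area is an image of the volume of the punctured ball, so a mean over directions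
  is an integral over that ball. Evenness makes the sign of the representative irrelevant.\<close>

lemma nn_integral_uniform_direction:
  fixes g :: "'a::euclidean_space \<Rightarrow> ennreal"
  assumes [measurable]: "g \<in> borel_measurable borel" and even: "\<And>u. g (- u) = g u"
  shows "(\<integral>\<^sup>+c. g (direction_rep c) \<partial>uniform_direction) =
    of_nat DIM('a) / emeasure surface_area (sphere (0::'a) 1) *
    (\<integral>\<^sup>+y. g (y /\<^sub>R norm y) * indicator (cball 0 1 - {0}) y \<partial>lborel)"
proof -
  let ?S = "sphere (0::'a) 1"
  let ?cl = "\<lambda>u::'a. antipodal `` {u}"
  note [measurable] = uniform_direction_class_measurable
  have m1: "(\<lambda>u. g (direction_rep (?cl u))) \<in> borel_measurable (restrict_space borel ?S)"
    using measurable_compose[OF measurable_antipodal_class, of "\<lambda>c. g (direction_rep c)" borel] by measurable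
  then have m2: "(\<lambda>u. g (direction_rep (?cl u))) \<in> borel_measurable (surface_area :: 'a measure)"
    by (simp cong: measurable_cong_sets)
  have "(\<integral>\<^sup>+c. g (direction_rep c) \<partial>uniform_direction) =
      (\<integral>\<^sup>+u. g (direction_rep (?cl u)) \<partial>uniform_measure surface_area ?S)"
    unfolding uniform_direction_def by (rule nn_integral_distr) measurable
  also have "\<dots> = (\<integral>\<^sup>+u. g (direction_rep (?cl u)) * indicator ?S u \<partial>surface_area) / emeasure surface_area ?S"
    using m2 by (intro nn_integral_uniform_measure) (auto simp: sets_restrict_space)
  also have "(\<integral>\<^sup>+u. g (direction_rep (?cl u)) * indicator ?S u \<partial>surface_area) = (\<integral>\<^sup>+u. g (direction_rep (?cl u)) \<partial>surface_area)"
    by (intro nn_integral_cong) auto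
  also have "\<dots> = of_nat DIM('a) *
      (\<integral>\<^sup>+y. g (direction_rep (?cl (y /\<^sub>R norm y))) \<partial>restrict_space lborel (cball 0 1 - {0}))"
    unfolding surface_area_def
    using m1 by (subst nn_integral_scale_measure) (auto simp: nn_integral_distr[OF measurable_normalize])
  also have "(\<integral>\<^sup>+y. g (direction_rep (?cl (y /\<^sub>R norm y))) \<partial>restrict_space lborel (cball 0 1 - {0})) =
      (\<integral>\<^sup>+y. g (direction_rep (?cl (y /\<^sub>R norm y))) * indicator (cball 0 1 - {0}) y \<partial>lborel)"
    by (rule nn_integral_restrict_space) simp
  also have "\<dots> = (\<integral>\<^sup>+y. g (y /\<^sub>R norm y) * indicator (cball 0 1 - {0}) y \<partial>lborel)"
  proof (rule nn_integral_cong_AE)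
    \<comment> \<open>Discarding this hyperplane removes the classes on which
      \<open>direction_rep\<close> takes its default value \<open>pole\<close>.\<close>
    have "AE y in lborel. y \<notin> {x::'a. x \<bullet> pole = 0}"
      by (rule AE_not_in[OF null_sets_hyperplane[OF norm_pole]])
    then show "AE y in lborel. g (direction_rep (?cl (y /\<^sub>R norm y))) * indicator (cball 0 1 - {0}) y
        = g (y /\<^sub>R norm y) * indicator (cball 0 1 - {0}) y"
    proof eventually_elim
      case (elim y)
      then have "y \<noteq> 0" by auto
      then have n: "norm (y /\<^sub>R norm y) = 1" by simp
      show ?case
        unfolding direction_rep_class[OF n] using elim \<open>y \<noteq> 0\<close> by (auto simp: even zero_less_mult_iff mult_less_0_iff)
    qed
  qed
  finally show ?thesis
    by (simp add: divide_ennreal_def ac_simps)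
qed

section \<open>Mean length of a set on the lines through a point\<close>

lemma nn_integral_lborel_affine:
  fixes f :: "'a::euclidean_space \<Rightarrow> ennreal"
  assumes [measurable]: "f \<in> borel_measurable borel" and c: "c \<noteq> 0"
  shows "(\<integral>\<^sup>+x. f x \<partial>lborel) = ennreal (\<bar>c\<bar> ^ DIM('a)) * (\<integral>\<^sup>+x. f (t + c *\<^sub>R x) \<partial>lborel)"
  by (subst lborel_affine[OF c, of t])
    (simp add: nn_integral_density nn_integral_distr nn_integral_cmult)

lemma line_length_normalize:
  fixes F :: "'a::euclidean_space set"
  assumes [measurable]: "F \<in> sets borel" and y: "y \<noteq> 0"
  shows "line_length (y /\<^sub>R norm y) F x =
    ennreal (norm y) * (\<integral>\<^sup>+s. indicator F (x + s *\<^sub>R y) \<partial>lborel)"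
  unfolding line_length_eq_nn_integral[OF assms(1)]
  using y by (subst nn_integral_real_affine[where c="norm y" and t=0]) (auto simp: field_simps)

text \<open>The integrand is at least its value at \<open>2 * \<rho>\<close> on an interval of
  length \<open>\<rho>\<close>, which leaves \<open>1 / 2 * (1 / (2 * \<rho>)) ^ k\<close>; then
  \<open>\<rho> \<le> 2 * R\<close>. In the application, \<open>Suc k\<close> is the
  dimension.\<close>

lemma scale_integral_ge:
  fixes \<rho> R :: real
  assumes \<rho>: "0 < \<rho>" "\<rho> \<le> 2 * R"
  shows "ennreal (1 / 2 * (1 / (4 * R)) ^ k) \<le>
    (\<integral>\<^sup>+s. ennreal ((1 / s) ^ Suc k) * indicator {\<rho>..2 * \<rho>} s \<partial>lborel)"
proof -
  have "1 / 2 * (1 / (4 * R)) ^ k \<le> 1 / 2 * (1 / (2 * \<rho>)) ^ k"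
    using \<rho> by (intro mult_left_mono power_mono divide_left_mono) auto
  also have "\<dots> = (1 / (2 * \<rho>)) ^ Suc k * \<rho>" using \<rho> by simp
  finally have "ennreal (1 / 2 * (1 / (4 * R)) ^ k) \<le> ennreal ((1 / (2 * \<rho>)) ^ Suc k * \<rho>)"
    by (rule ennreal_leI)
  also have "\<dots> = (\<integral>\<^sup>+s. ennreal ((1 / (2 * \<rho>)) ^ Suc k) * indicator {\<rho>..2 * \<rho>} s \<partial>lborel)"
    using \<rho> by (subst nn_integral_cmult_indicator) (auto simp flip: ennreal_mult)
  also have "\<dots> \<le> (\<integral>\<^sup>+s. ennreal ((1 / s) ^ Suc k) * indicator {\<rho>..2 * \<rho>} s \<partial>lborel)"
    using \<rho> by (intro nn_integral_mono)
      (auto simp: indicator_def intro!: ennreal_leI power_mono divide_left_mono simp del: power_Suc)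
  finally show ?thesis .
qed

text \<open>
  The substitution \<open>z = x + s y\<close> turns directions into points. The restriction to
  \<open>1 / 2 \<le> norm y\<close> amounts to \<open>norm (z - x) \<le> s \<le> 2 * norm (z - x)\<close>, and the integral of
  \<open>s\<^bsup>-d\<^esup>\<close> over this range is bounded below since \<open>norm (z - x) \<le> 2 * R\<close>.
\<close>

lemma nn_integral_line_length_normalize_ge:
  fixes F :: "'a::euclidean_space set"
  assumes [measurable]: "F \<in> sets borel" and F: "F \<subseteq> cball 0 R" and x: "x \<in> cball 0 R"
  shows "ennreal (1 / 4 * (1 / (4 * R)) ^ (DIM('a) - 1)) * emeasure lborel F \<le>
    (\<integral>\<^sup>+y. line_length (y /\<^sub>R norm y) F x * indicator (cball 0 1 - {0}) y \<partial>lborel)"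
proof -
  let ?d = "DIM('a)"
  \<comment> \<open>The factor \<open>1 / 2\<close> is a lower bound for the \<open>norm y\<close>
    that \<open>line_length_normalize\<close> produces, and only the half-line \<open>s > 0\<close>
    is kept. \<open>H\<close> is \<open>G\<close> in the variable
    \<open>z = x + s *\<^sub>R y\<close>, with the Jacobian factor
    \<open>(1 / s) ^ ?d\<close>.\<close>
  define G where "G s y = ennreal (1 / 2) * indicator {y. 1 / 2 \<le> norm y \<and> norm y \<le> 1} y *
      indicator F (x + s *\<^sub>R y) * indicator {0<..} s" for s :: real and y :: 'a
  define H where "H s z = ennreal (1 / 2) * ennreal ((1 / s) ^ ?d) * indicator F z *
      indicator {0<..} s * indicator {s. norm (z - x) \<le> s \<and> s \<le> 2 * norm (z - x)} s"
    for s :: real and z :: 'a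
  have [measurable]: "case_prod G \<in> borel_measurable (lborel \<Otimes>\<^sub>M lborel)"
    "case_prod H \<in> borel_measurable (lborel \<Otimes>\<^sub>M lborel)"
    unfolding G_def H_def by measurable
  have GH: "(\<integral>\<^sup>+y. G s y \<partial>lborel) = (\<integral>\<^sup>+z. H s z \<partial>lborel)" for s
  proof (cases "0 < s")
    case True
    have "(\<integral>\<^sup>+z. H s z \<partial>lborel) = ennreal (s ^ ?d) * (\<integral>\<^sup>+y. H s (x + s *\<^sub>R y) \<partial>lborel)"
      using True by (subst nn_integral_lborel_affine[where c=s and t=x]) auto
    also have "\<dots> = (\<integral>\<^sup>+y. ennreal (s ^ ?d) * H s (x + s *\<^sub>R y) \<partial>lborel)"
      by (intro nn_integral_cmult[symmetric]) auto
    also have "\<dots> = (\<integral>\<^sup>+y. G s y \<partial>lborel)"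
    proof (rule nn_integral_cong)
      fix y :: 'a
      have "ennreal (s ^ ?d) * ennreal ((1 / s) ^ ?d) = 1"
        using True by (subst ennreal_mult[symmetric]) (auto simp flip: power_mult_distrib)
      then have "ennreal (s ^ ?d) * (b * ennreal ((1 / s) ^ ?d)) = b" for b
        by (metis mult.left_commute mult.right_neutral)
      then show "ennreal (s ^ ?d) * H s (x + s *\<^sub>R y) = G s y"
        using True unfolding G_def H_def
        by (cases "1 / 2 \<le> norm y \<and> norm y \<le> 1") (auto simp: indicator_def)
    qed
    finally show ?thesis by simp
  qed (simp add: G_def H_def)
  \<comment> \<open>At \<open>z = x\<close> the range of \<open>s\<close> degenerates; this single
    point is null.\<close>
  have Hz: "ennreal (1 / 4 * (1 / (4 * R)) ^ (?d - 1)) * indicator F z \<le> (\<integral>\<^sup>+s. H s z \<partial>lborel)"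
    if "z \<noteq> x" for z
  proof (cases "z \<in> F")
    case True
    let ?\<rho> = "norm (z - x)"
    have d: "Suc (?d - 1) = ?d" by simp
    have "?\<rho> \<le> 2 * R"
      using norm_triangle_ineq4[of z x] True F x by auto
    then have *: "ennreal (1 / 2 * (1 / (4 * R)) ^ (?d - 1)) \<le>
        (\<integral>\<^sup>+s. ennreal ((1 / s) ^ ?d) * indicator {?\<rho>..2 * ?\<rho>} s \<partial>lborel)"
      using scale_integral_ge[of ?\<rho> R "?d - 1"] that unfolding d by simp
    have "ennreal (1 / 4 * (1 / (4 * R)) ^ (?d - 1)) =
        ennreal (1 / 2) * ennreal (1 / 2 * (1 / (4 * R)) ^ (?d - 1))"
      by (subst ennreal_mult'[symmetric]) (auto simp: mult.assoc[symmetric])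
    also have "\<dots> \<le> ennreal (1 / 2) * (\<integral>\<^sup>+s. ennreal ((1 / s) ^ ?d) * indicator {?\<rho>..2 * ?\<rho>} s \<partial>lborel)"
      using * by (rule mult_left_mono) simp
    also have "\<dots> = (\<integral>\<^sup>+s. ennreal (1 / 2) * (ennreal ((1 / s) ^ ?d) * indicator {?\<rho>..2 * ?\<rho>} s) \<partial>lborel)"
      by (rule nn_integral_cmult[symmetric]) measurable
    also have "\<dots> = (\<integral>\<^sup>+s. H s z \<partial>lborel)"
      using True that by (intro nn_integral_cong) (auto simp: H_def indicator_def ac_simps intro: less_le_trans)
    finally show ?thesis using True by simp
  qed simp
  have "ennreal (1 / 4 * (1 / (4 * R)) ^ (?d - 1)) * emeasure lborel F =
      (\<integral>\<^sup>+z. ennreal (1 / 4 * (1 / (4 * R)) ^ (?d - 1)) * indicator F z \<partial>lborel)"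
    by (simp add: nn_integral_cmult_indicator)
  also have "\<dots> \<le> (\<integral>\<^sup>+z. (\<integral>\<^sup>+s. H s z \<partial>lborel) \<partial>lborel)"
    by (intro nn_integral_mono_AE eventually_mono[OF AE_lborel_singleton[of x]] Hz)
  also have "\<dots> = (\<integral>\<^sup>+s. (\<integral>\<^sup>+z. H s z \<partial>lborel) \<partial>lborel)"
    by (rule lborel_pair.Fubini') measurable
  also have "\<dots> = (\<integral>\<^sup>+s. (\<integral>\<^sup>+y. G s y \<partial>lborel) \<partial>lborel)" by (simp add: GH)
  also have "\<dots> = (\<integral>\<^sup>+y. (\<integral>\<^sup>+s. G s y \<partial>lborel) \<partial>lborel)"
    by (rule lborel_pair.Fubini'[symmetric]) measurable
  also have "\<dots> \<le> (\<integral>\<^sup>+y. line_length (y /\<^sub>R norm y) F x * indicator (cball 0 1 - {0}) y \<partial>lborel)"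
  proof (rule nn_integral_mono)
    fix y :: 'a
    show "(\<integral>\<^sup>+s. G s y \<partial>lborel) \<le> line_length (y /\<^sub>R norm y) F x * indicator (cball 0 1 - {0}) y"
    proof (cases "1 / 2 \<le> norm y \<and> norm y \<le> 1")
      case True
      then have "y \<noteq> 0" by auto
      have "(\<integral>\<^sup>+s. G s y \<partial>lborel) \<le> (\<integral>\<^sup>+s. ennreal (norm y) * indicator F (x + s *\<^sub>R y) \<partial>lborel)"
        using True ennreal_leI[of "1 / 2" "norm y"]
        by (intro nn_integral_mono) (auto simp: G_def indicator_def)
      also have "\<dots> = line_length (y /\<^sub>R norm y) F x"
        using \<open>y \<noteq> 0\<close> by (simp add: line_length_normalize nn_integral_cmult)
      finally show ?thesis using True \<open>y \<noteq> 0\<close> by simp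
    next
      case False
      then have "G s y = 0" for s by (simp add: G_def)
      then show ?thesis by simp
    qed
  qed
  finally show ?thesis .
qed

section \<open>Joint measurability in directions and points\<close>

lemma measurable_emeasure_section:
  assumes [measurable]: "{z \<in> space (M \<Otimes>\<^sub>M lborel). snd z \<in> G (fst z)} \<in> sets (M \<Otimes>\<^sub>M lborel)"
    and [measurable]: "B \<in> sets borel"
  shows "(\<lambda>\<omega>. emeasure lborel (G \<omega> - (B :: 'a::euclidean_space set))) \<in> borel_measurable M"
proof (rule lborel.measurable_emeasure)
  have "{z \<in> space (M \<Otimes>\<^sub>M lborel). snd z \<in> G (fst z) - B} =
    {z \<in> space (M \<Otimes>\<^sub>M lborel). snd z \<in> G (fst z)} - {z \<in> space (M \<Otimes>\<^sub>M lborel). snd z \<in> B}"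
    by auto
  also have "\<dots> \<in> sets (M \<Otimes>\<^sub>M lborel)" by measurable
  finally show "{z \<in> space (M \<Otimes>\<^sub>M lborel). snd z \<in> G (fst z) - B} \<in> sets (M \<Otimes>\<^sub>M lborel)" .
qed auto

text \<open>Joint measurability is the property that survives iteration: the length of a section is
  an integral of the indicator of one set in the product space, hence measurable in the parameter
  and the point together.\<close>

lemma sets_steiner_open_section:
  fixes u :: "'b \<Rightarrow> 'a::euclidean_space"
  assumes G[measurable]: "{z \<in> space (M \<Otimes>\<^sub>M lborel). snd z \<in> G (fst z)} \<in> sets (M \<Otimes>\<^sub>M lborel)"
    and [measurable]: "u \<in> borel_measurable M"
  shows "{z \<in> space (M \<Otimes>\<^sub>M lborel). snd z \<in> steiner_open (u (fst z)) (G (fst z))} \<in> sets (M \<Otimes>\<^sub>M lborel)"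
proof -
  let ?G = "{z \<in> space (M \<Otimes>\<^sub>M lborel). snd z \<in> G (fst z)}"
  have "line_length (u \<omega>) (G \<omega>) x = (\<integral>\<^sup>+t. indicator ?G (\<omega>, x + t *\<^sub>R u \<omega>) \<partial>lborel)"
    if \<omega>: "\<omega> \<in> space M" for \<omega> x
  proof -
    have "Pair \<omega> -` ?G \<in> sets lborel"
      using sets_Pair1[OF G] .
    moreover have "Pair \<omega> -` ?G = G \<omega>" using \<omega> by (auto simp: space_pair_measure)
    ultimately have "G \<omega> \<in> sets borel" by simp
    then show ?thesis
      using \<omega> by (auto simp: line_length_eq_nn_integral indicator_def space_pair_measure intro!: nn_integral_cong)
  qed
  then have "{z \<in> space (M \<Otimes>\<^sub>M lborel). snd z \<in> steiner_open (u (fst z)) (G (fst z))} =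
    {z \<in> space (M \<Otimes>\<^sub>M lborel). ennreal (2 * \<bar>snd z \<bullet> u (fst z)\<bar>) <
      (\<integral>\<^sup>+t. indicator ?G (fst z, snd z + t *\<^sub>R u (fst z)) \<partial>lborel)}"
    by (auto simp: steiner_open_def space_pair_measure)
  also have "\<dots> \<in> sets (M \<Otimes>\<^sub>M lborel)"
    by measurable
  finally show ?thesis .
qed

section \<open>The expected decrease\<close>

lemma space_uniform_direction [simp]:
  "space (uniform_direction :: 'a::euclidean_space set measure) = sphere 0 1 // antipodal"
  by (simp add: uniform_direction_def)

lemma sets_uniform_direction [simp, measurable_cong]:
  "sets (uniform_direction :: 'a::euclidean_space set measure) = sets direction_algebra"
  by (simp add: uniform_direction_def)

text \<open>The constant is obtained before \<open>F\<close> and \<open>x\<close>. This uniformity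
  lets one constant serve for all the sets that occur in the iteration.\<close>

lemma nn_integral_line_length_direction_ge:
  fixes R :: real
  assumes R: "0 < R"
  obtains c :: real where "0 < c" and
    "\<And>(F :: 'a::euclidean_space set) x. F \<in> sets borel \<Longrightarrow> F \<subseteq> cball 0 R \<Longrightarrow> x \<in> cball 0 R \<Longrightarrow>
      ennreal c * emeasure lborel F \<le> (\<integral>\<^sup>+d. line_length (direction_rep d) F x \<partial>uniform_direction)"
proof -
  let ?K = "of_nat DIM('a) / emeasure surface_area (sphere (0::'a) 1)"
  let ?q = "1 / 4 * (1 / (4 * R)) ^ (DIM('a) - 1)"
  have "?K \<noteq> \<infinity>" "?K \<noteq> 0"
    using emeasure_surface_area_sphere[where 'a='a]
    by (auto simp: ennreal_divide_eq_top_iff ennreal_divide_eq_0_iff)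
  then obtain k where k: "?K = ennreal k" "0 < k"
    by (cases ?K) auto
  have "0 < k * ?q" using k R by simp
  moreover have "ennreal (k * ?q) * emeasure lborel F \<le> (\<integral>\<^sup>+d. line_length (direction_rep d) F x \<partial>uniform_direction)"
    if [measurable]: "F \<in> sets borel" and F: "F \<subseteq> cball 0 R" and x: "x \<in> cball 0 R" for F :: "'a set" and x
  proof -
    note [measurable] = borel_measurable_line_length
    have "ennreal (k * ?q) * emeasure lborel F = ?K * (ennreal ?q * emeasure lborel F)"
      unfolding k using k R by (subst ennreal_mult) (auto simp: mult.assoc)
    also have "\<dots> \<le> ?K * (\<integral>\<^sup>+y. line_length (y /\<^sub>R norm y) F x * indicator (cball 0 1 - {0}) y \<partial>lborel)"
      by (intro mult_left_mono nn_integral_line_length_normalize_ge that) simp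
    also have "\<dots> = (\<integral>\<^sup>+d. line_length (direction_rep d) F x \<partial>uniform_direction)"
      by (subst nn_integral_uniform_direction) (simp_all add: line_length_minus)
    finally show ?thesis .
  qed
  ultimately show ?thesis by (rule that)
qed

text \<open>The inequality on single lines is integrated over all lines; the product of lengths
  becomes an integral over the points of \<open>E - cball 0 r\<close>.\<close>

lemma steiner_open_deficit:
  fixes E :: "'a::euclidean_space set"
  assumes u: "norm u = 1" and r: "0 \<le> r" "r \<le> R"
    and [measurable]: "E \<in> sets borel" and E: "E \<subseteq> cball 0 R"
  shows "ennreal (2 * R) * emeasure lborel (steiner_open u E - cball 0 r) +
      (\<integral>\<^sup>+x. indicator (E - cball 0 r) x * line_length u (cball 0 r - E) x \<partial>lborel)
    \<le> ennreal (2 * R) * emeasure lborel (E - cball 0 r)"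
proof -
  note [measurable] = borel_measurable_line_length
  let ?B = "cball (0::'a) r" and ?w = "\<lambda>x. indicator {0..1} (x \<bullet> u) :: ennreal"
  have "ennreal (2 * R) * emeasure lborel (steiner_open u E - ?B) +
      (\<integral>\<^sup>+x. indicator (E - ?B) x * line_length u (?B - E) x \<partial>lborel) =
    (\<integral>\<^sup>+x. (ennreal (2 * R) * line_length u (steiner_open u E - ?B) x +
      line_length u (E - ?B) x * line_length u (?B - E) x) * ?w x \<partial>lborel)"
    by (subst emeasure_lines[OF u], simp)
      (simp add: nn_integral_section_line_length[OF u] distrib_right nn_integral_add nn_integral_cmult mult.assoc)
  also have "\<dots> \<le> (\<integral>\<^sup>+x. ennreal (2 * R) * line_length u (E - ?B) x * ?w x \<partial>lborel)"
    by (intro nn_integral_mono mult_right_mono line_length_steiner_open_diff_cball[OF u r _ E]) auto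
  also have "\<dots> = ennreal (2 * R) * emeasure lborel (E - ?B)"
    by (subst emeasure_lines[OF u]) (simp_all add: nn_integral_cmult mult.assoc)
  finally show ?thesis .
qed

lemma emeasure_Diff_eq_Diff:
  assumes [measurable]: "E \<in> sets M" "B \<in> sets M"
    and eq: "emeasure M E = emeasure M B" and fin: "emeasure M B \<noteq> \<infinity>"
  shows "emeasure M (B - E) = emeasure M (E - B)"
proof -
  have "emeasure M (E \<inter> B) + emeasure M (E - B) = emeasure M E"
    by (subst plus_emeasure) (auto intro!: arg_cong[where f="emeasure M"])
  also have "\<dots> = emeasure M (E \<inter> B) + emeasure M (B - E)"
    unfolding eq by (subst plus_emeasure) (auto intro!: arg_cong[where f="emeasure M"])
  finally have "emeasure M (E \<inter> B) + emeasure M (B - E) = emeasure M (E \<inter> B) + emeasure M (E - B)"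
    by (rule sym)
  moreover have "emeasure M (E \<inter> B) \<noteq> \<infinity>"
    using fin emeasure_mono[of "E \<inter> B" B M] by (auto simp: top_unique)
  ultimately show ?thesis by (simp only: ennreal_add_left_cancel) auto
qed

text \<open>The inequality for a fixed direction is averaged. Fubini's theorem puts the mean over
  directions inside, where for each point of \<open>E - cball 0 r\<close> the mean length of
  \<open>cball 0 r - E\<close> is at least a constant times its volume.\<close>

lemma expected_deficit:
  fixes r R :: real
  assumes R: "0 < R" and r: "0 \<le> r" "r \<le> R"
  obtains c :: real where "0 < c" and
    "\<And>E :: 'a::euclidean_space set. E \<in> sets borel \<Longrightarrow> E \<subseteq> cball 0 R \<Longrightarrow>
      emeasure lborel E = emeasure lborel (cball (0::'a) r) \<Longrightarrow>
      (\<integral>\<^sup>+d. emeasure lborel (steiner_open (direction_rep d) E - cball 0 r) \<partial>uniform_direction) +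
        ennreal c * (emeasure lborel (E - cball 0 r))\<^sup>2 \<le> emeasure lborel (E - cball 0 r)"
proof -
  obtain c where c: "0 < c" and ge:
    "\<And>(F :: 'a set) x. F \<in> sets borel \<Longrightarrow> F \<subseteq> cball 0 R \<Longrightarrow> x \<in> cball 0 R \<Longrightarrow>
      ennreal c * emeasure lborel F \<le> (\<integral>\<^sup>+d. line_length (direction_rep d) F x \<partial>uniform_direction)"
    by (rule nn_integral_line_length_direction_ge[OF R, where 'a='a]) (rule that)
  \<comment> \<open>The averaged inequality carries the factor \<open>2 * R\<close> on the deficits;
    dividing by it gives this constant.\<close>
  have "0 < c / (2 * R)" using c R by simp
  moreover have "(\<integral>\<^sup>+d. emeasure lborel (steiner_open (direction_rep d) E - cball 0 r) \<partial>uniform_direction) +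
        ennreal (c / (2 * R)) * (emeasure lborel (E - cball 0 r))\<^sup>2 \<le> emeasure lborel (E - cball 0 r)"
    if [measurable]: "E \<in> sets borel" and E: "E \<subseteq> cball 0 R"
      and vol: "emeasure lborel E = emeasure lborel (cball (0::'a) r)" for E :: "'a set"
  proof -
    note [measurable] = borel_measurable_line_length
    interpret prob_space "uniform_direction :: 'a set measure" by (rule prob_space_uniform_direction)
    interpret P: pair_sigma_finite "uniform_direction :: 'a set measure" "lborel :: 'a measure" ..
    let ?B = "cball (0::'a) r" and ?U = "uniform_direction :: 'a set measure"
    let ?D = "E - ?B" and ?F = "?B - E"
    have DF: "emeasure lborel ?F = emeasure lborel ?D"
      using emeasure_Diff_eq_Diff[of E lborel ?B] that(1) vol emeasure_lborel_cball_finite[of "0::'a" r]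
      by simp
    have [measurable]: "(\<lambda>d. emeasure lborel (steiner_open (direction_rep d) E - ?B)) \<in> borel_measurable ?U"
    proof (intro measurable_emeasure_section sets_steiner_open_section)
      show "{z \<in> space (?U \<Otimes>\<^sub>M lborel). snd z \<in> E} \<in> sets (?U \<Otimes>\<^sub>M lborel)"
        by measurable
    qed measurable
    have [measurable]: "(\<lambda>(d, x). indicator ?D x * line_length (direction_rep d) ?F x) \<in> borel_measurable (?U \<Otimes>\<^sub>M lborel)"
      unfolding split_beta'
    proof (intro borel_measurable_times_ennreal borel_measurable_line_length)
      show "(\<lambda>z. indicator ?D (snd z)) \<in> borel_measurable (?U \<Otimes>\<^sub>M lborel)"
        using that(1) by (intro measurable_compose[OF measurable_snd] borel_measurable_indicator) auto
    qed auto
    have ind: "(\<integral>\<^sup>+x. indicator ?D x * k \<partial>lborel) = emeasure lborel ?D * k" for k :: ennreal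
      using that(1) by (subst nn_integral_multc) (auto intro!: borel_measurable_indicator)
    \<comment> \<open>Equal volumes split the square: one factor is read as the volume of
      \<open>?F\<close>, the other as an integral over \<open>?D\<close>.\<close>
    have "ennreal (2 * R) * (\<integral>\<^sup>+d. emeasure lborel (steiner_open (direction_rep d) E - ?B) \<partial>?U) +
        ennreal c * (emeasure lborel ?D)\<^sup>2 =
        ennreal (2 * R) * (\<integral>\<^sup>+d. emeasure lborel (steiner_open (direction_rep d) E - ?B) \<partial>?U) +
        (\<integral>\<^sup>+x. indicator ?D x * (ennreal c * emeasure lborel ?F) \<partial>lborel)"
      unfolding ind DF by (simp only: power2_eq_square ac_simps)
    also have "\<dots> \<le> ennreal (2 * R) * (\<integral>\<^sup>+d. emeasure lborel (steiner_open (direction_rep d) E - ?B) \<partial>?U) +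
        (\<integral>\<^sup>+x. indicator ?D x * (\<integral>\<^sup>+d. line_length (direction_rep d) ?F x \<partial>?U) \<partial>lborel)"
      using E r by (intro add_left_mono nn_integral_mono) (auto simp: indicator_def intro!: ge)
    also have "(\<integral>\<^sup>+x. indicator ?D x * (\<integral>\<^sup>+d. line_length (direction_rep d) ?F x \<partial>?U) \<partial>lborel) =
        (\<integral>\<^sup>+x. (\<integral>\<^sup>+d. indicator ?D x * line_length (direction_rep d) ?F x \<partial>?U) \<partial>lborel)"
      by (intro nn_integral_cong nn_integral_cmult[symmetric]) measurable
    also have "\<dots> = (\<integral>\<^sup>+d. (\<integral>\<^sup>+x. indicator ?D x * line_length (direction_rep d) ?F x \<partial>lborel) \<partial>?U)"
      by (rule P.Fubini') measurable
    also have "ennreal (2 * R) * (\<integral>\<^sup>+d. emeasure lborel (steiner_open (direction_rep d) E - ?B) \<partial>?U) + \<dots> =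
        (\<integral>\<^sup>+d. ennreal (2 * R) * emeasure lborel (steiner_open (direction_rep d) E - ?B) +
          (\<integral>\<^sup>+x. indicator ?D x * line_length (direction_rep d) ?F x \<partial>lborel) \<partial>?U)"
      by (subst nn_integral_add) (simp_all add: nn_integral_cmult)
    also have "\<dots> \<le> (\<integral>\<^sup>+d. ennreal (2 * R) * emeasure lborel ?D \<partial>?U)"
      using r E by (intro nn_integral_mono steiner_open_deficit norm_direction_rep) auto
    also have "\<dots> = ennreal (2 * R) * emeasure lborel ?D"
      by (simp add: emeasure_space_1[simplified])
    finally have "ennreal (1 / (2 * R)) * (ennreal (2 * R) * (\<integral>\<^sup>+d. emeasure lborel (steiner_open (direction_rep d) E - ?B) \<partial>?U) +
        ennreal c * (emeasure lborel ?D)\<^sup>2) \<le> ennreal (1 / (2 * R)) * (ennreal (2 * R) * emeasure lborel ?D)"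
      by (rule mult_left_mono) simp
    moreover have "ennreal (1 / (2 * R)) * (ennreal (2 * R) * z) = z" for z
      using R by (simp flip: mult.assoc ennreal_mult)
    moreover have "ennreal (1 / (2 * R)) * (ennreal c * z) = ennreal (c / (2 * R)) * z" for z
      using R c by (simp flip: mult.assoc ennreal_mult)
    ultimately show ?thesis by (simp add: distrib_left)
  qed
  ultimately show ?thesis by (rule that)
qed

section \<open>Iteration\<close>

text \<open>With \<open>direction_rep\<close> in place of \<open>SOME\<close>, and Borel sets
  throughout when \<open>E\<close> is Borel, the iterates depend measurably on
  \<open>U\<close>.\<close>

primrec steiner_open_iter :: "(nat \<Rightarrow> 'a::euclidean_space set) \<Rightarrow> 'a set \<Rightarrow> nat \<Rightarrow> 'a set" where
  "steiner_open_iter U E 0 = E"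
| "steiner_open_iter U E (Suc n) = steiner_open (direction_rep (U n)) (steiner_open_iter U E n)"

lemma steiner_open_iter_case_nat:
  "steiner_open_iter (case_nat d U) E (Suc n) = steiner_open_iter U (steiner_open (direction_rep d) E) n"
  by (induction n) simp_all

lemma steiner_open_iter_invariants:
  fixes E :: "'a::euclidean_space set"
  assumes U: "\<And>n. U n \<in> sphere 0 1 // antipodal" and R: "0 \<le> R"
    and E: "E \<in> sets borel" "E \<subseteq> cball 0 R"
  shows "steiner_open_iter U E n \<in> sets borel" "steiner_open_iter U E n \<subseteq> cball 0 R"
    "emeasure lborel (steiner_open_iter U E n) = emeasure lborel E"
proof -
  have "steiner_open_iter U E n \<in> sets borel \<and> steiner_open_iter U E n \<subseteq> cball 0 R \<and>
    emeasure lborel (steiner_open_iter U E n) = emeasure lborel E"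
  proof (induction n)
    case (Suc n)
    have n1: "norm (direction_rep (U n)) = 1" by (rule norm_direction_rep[OF U])
    show ?case
      using Suc steiner_open_subset_cball[OF n1 R, of "steiner_open_iter U E n"]
        emeasure_steiner_open[OF n1, of "steiner_open_iter U E n"]
      by (simp add: sets_steiner_open)
  qed (use E in simp)
  then show "steiner_open_iter U E n \<in> sets borel" "steiner_open_iter U E n \<subseteq> cball 0 R"
    "emeasure lborel (steiner_open_iter U E n) = emeasure lborel E" by auto
qed

text \<open>Each symmetrization preserves agreement up to a null set, though the null set changes
  with \<open>n\<close>. The second condition on \<open>U\<close> excludes the equator, where
  \<open>direction_rep\<close> symmetrizes in a direction outside the class.\<close>

lemma steiner_iter_null_diff:
  fixes A :: "'a::euclidean_space set"
  assumes U: "\<And>n. U n \<in> sphere 0 1 // antipodal" "\<And>n. direction_rep (U n) \<in> U n"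
    and E: "E \<in> sets borel" and N: "N \<in> null_sets lborel" "(A - E) \<union> (E - A) \<subseteq> N"
  shows "\<exists>N\<in>null_sets lborel. (steiner_iter U A n - steiner_open_iter U E n) \<union>
    (steiner_open_iter U E n - steiner_iter U A n) \<subseteq> N \<and> steiner_open_iter U E n \<in> sets borel"
proof (induction n)
  case (Suc n)
  then obtain N where N: "N \<in> null_sets lborel"
    "(steiner_iter U A n - steiner_open_iter U E n) \<union>
      (steiner_open_iter U E n - steiner_iter U A n) \<subseteq> N" "steiner_open_iter U E n \<in> sets borel"
    by blast
  have n1: "norm (direction_rep (U n)) = 1" by (rule norm_direction_rep[OF U(1)])
  obtain u where u: "U n = antipodal `` {u}"
    using U(1)[of n] by (rule quotientE)
  \<comment> \<open>As \<open>direction_rep (U n)\<close> generates the class, the element picked by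
    \<open>SOME\<close> gives the same symmetral.\<close>
  have "U n = antipodal `` {direction_rep (U n)}"
    using U(2)[of n] equiv_class_eq[OF equiv_antipodal, of u "direction_rep (U n)"] u by blast
  then have "steiner_iter U A (Suc n) = steiner (direction_rep (U n)) (steiner_iter U A n)"
    using steiner_direction_class[OF n1] by simp
  then show ?case
    using steiner_null_diff[OF n1 N(3,1,2)] N(3) by (metis sets_steiner_open steiner_open_iter.simps(2))
qed (use E N in auto)

lemma sets_steiner_open_iter:
  fixes E :: "'a::euclidean_space set"
  assumes E: "E \<in> sets borel"
  defines "S \<equiv> Pi\<^sub>M (UNIV :: nat set) (\<lambda>_. uniform_direction :: 'a set measure)"
  shows "{z \<in> space (S \<Otimes>\<^sub>M lborel). snd z \<in> steiner_open_iter (fst z) E n} \<in> sets (S \<Otimes>\<^sub>M lborel)"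
proof (induction n)
  case 0
  have "snd -` E \<inter> space (S \<Otimes>\<^sub>M lborel) \<in> sets (S \<Otimes>\<^sub>M lborel)"
    using E by (intro measurable_sets[OF measurable_snd]) simp
  then show ?case by (simp add: vimage_def Int_def conj_commute)
next
  case (Suc n)
  have [measurable]: "(\<lambda>U. direction_rep (U n)) \<in> borel_measurable S"
    unfolding S_def by measurable
  from sets_steiner_open_section[OF Suc this] show ?case by simp
qed

lemma sequence_space_uniform_direction:
  "sequence_space (uniform_direction :: 'a::euclidean_space set measure)"
proof -
  interpret prob_space "uniform_direction :: 'a set measure" by (rule prob_space_uniform_direction)
  show ?thesis by unfold_locales
qed

text \<open>
  The induction splits off the first direction, for arbitrary \<open>E\<close>: the remaining sequence of directions
  has the same law.
\<close>

lemma expected_square_deficit_sum: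
  fixes r R c :: real and E :: "'a::euclidean_space set"
  assumes r: "0 \<le> r" "r \<le> R" and R: "0 < R"
    and step: "\<And>E :: 'a::euclidean_space set. E \<in> sets borel \<Longrightarrow> E \<subseteq> cball 0 R \<Longrightarrow>
      emeasure lborel E = emeasure lborel (cball (0::'a) r) \<Longrightarrow>
      (\<integral>\<^sup>+d. emeasure lborel (steiner_open (direction_rep d) E - cball 0 r) \<partial>uniform_direction) +
        ennreal c * (emeasure lborel (E - cball 0 r))\<^sup>2 \<le> emeasure lborel (E - cball 0 r)"
    and E: "E \<in> sets borel" "E \<subseteq> cball 0 R" "emeasure lborel E = emeasure lborel (cball (0::'a) r)"
  shows "(\<integral>\<^sup>+U. (\<Sum>k<n. ennreal c * (emeasure lborel (steiner_open_iter U E k - cball 0 r))\<^sup>2)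
      \<partial>Pi\<^sub>M UNIV (\<lambda>_. uniform_direction)) \<le> emeasure lborel (E - cball 0 r)"
  using E
proof (induction n arbitrary: E)
  case (Suc n)
  let ?M = "uniform_direction :: 'a set measure" and ?B = "cball (0::'a) r"
  let ?f = "\<lambda>E. (emeasure lborel (E - ?B))\<^sup>2"
  interpret sequence_space ?M by (rule sequence_space_uniform_direction)
  interpret P: prob_space S by (rule prob_space_PiM) (rule prob_space_uniform_direction)
  have meas: "(\<lambda>U. \<Sum>k<n. ennreal c * ?f (steiner_open_iter U G k)) \<in> borel_measurable S"
    if "G \<in> sets borel" for G n
  proof -
    note [measurable] = measurable_emeasure_section[OF sets_steiner_open_iter[OF that], of ?B, simplified]
    show ?thesis by measurable
  qed
  have [measurable]: "(\<lambda>(d, U). case_nat d U) \<in> ?M \<Otimes>\<^sub>M S \<rightarrow>\<^sub>M S" by measurable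
  \<comment> \<open>The term with index \<open>0\<close> belongs to \<open>E\<close> itself and
    involves no direction; the others form the sum for the once symmetrized set.\<close>
  have sum: "(\<Sum>k<Suc n. ennreal c * ?f (steiner_open_iter (case_nat d U) E k)) =
      ennreal c * ?f E + (\<Sum>k<n. ennreal c * ?f (steiner_open_iter U (steiner_open (direction_rep d) E) k))" for d :: "'a set" and U
    unfolding sum.lessThan_Suc_shift steiner_open_iter_case_nat by simp
  have "(\<integral>\<^sup>+U. (\<Sum>k<Suc n. ennreal c * ?f (steiner_open_iter U E k)) \<partial>S) =
      (\<integral>\<^sup>+U. (\<Sum>k<Suc n. ennreal c * ?f (steiner_open_iter U E k)) \<partial>distr (?M \<Otimes>\<^sub>M S) S (\<lambda>(d, U). case_nat d U))"
    by (subst PiM_iter) simp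
  also have "\<dots> = (\<integral>\<^sup>+z. (\<Sum>k<Suc n. ennreal c * ?f (steiner_open_iter (case_nat (fst z) (snd z)) E k)) \<partial>(?M \<Otimes>\<^sub>M S))"
    by (subst nn_integral_distr) (simp_all add: meas Suc.prems split_beta' del: sum.lessThan_Suc)
  also have "\<dots> = (\<integral>\<^sup>+d. (\<integral>\<^sup>+U. (\<Sum>k<Suc n. ennreal c * ?f (steiner_open_iter (case_nat d U) E k)) \<partial>S) \<partial>?M)"
    using measurable_compose[OF \<open>(\<lambda>(d, U). case_nat d U) \<in> ?M \<Otimes>\<^sub>M S \<rightarrow>\<^sub>M S\<close> meas[OF Suc.prems(1), of "Suc n"]]
    by (subst P.nn_integral_fst[symmetric]) (simp_all add: split_beta' del: sum.lessThan_Suc)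
  \<comment> \<open>For fixed \<open>d\<close>, the induction hypothesis bounds the later terms by
    the deficit after the first step; \<open>step\<close> then bounds the mean of that deficit plus
    the term of \<open>E\<close> by the deficit of \<open>E\<close>.\<close>
  also have "\<dots> \<le> (\<integral>\<^sup>+d. ennreal c * ?f E + emeasure lborel (steiner_open (direction_rep d) E - ?B) \<partial>?M)"
  proof (rule nn_integral_mono)
    fix d assume "d \<in> space ?M"
    then have n1: "norm (direction_rep d) = 1" by (simp add: norm_direction_rep)
    have G: "steiner_open (direction_rep d) E \<in> sets borel" using Suc.prems by measurable
    have "(\<integral>\<^sup>+U. (\<Sum>k<Suc n. ennreal c * ?f (steiner_open_iter (case_nat d U) E k)) \<partial>S) =
      ennreal c * ?f E + (\<integral>\<^sup>+U. (\<Sum>k<n. ennreal c * ?f (steiner_open_iter U (steiner_open (direction_rep d) E) k)) \<partial>S)"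
      unfolding sum using P.emeasure_space_1 by (subst nn_integral_add) (simp_all add: meas G)
    also have "\<dots> \<le> ennreal c * ?f E + emeasure lborel (steiner_open (direction_rep d) E - ?B)"
      using steiner_open_subset_cball[OF n1 _ Suc.prems(2)] R Suc.prems
      by (intro add_left_mono Suc.IH G) (auto simp: emeasure_steiner_open[OF n1])
    finally show "(\<integral>\<^sup>+U. (\<Sum>k<Suc n. ennreal c * ?f (steiner_open_iter (case_nat d U) E k)) \<partial>S) \<le>
      ennreal c * ?f E + emeasure lborel (steiner_open (direction_rep d) E - ?B)" .
  qed
  also have "\<dots> = ennreal c * ?f E + (\<integral>\<^sup>+d. emeasure lborel (steiner_open (direction_rep d) E - ?B) \<partial>?M)"
  proof (subst nn_integral_add)
    show "(\<lambda>d. emeasure lborel (steiner_open (direction_rep d) E - ?B)) \<in> borel_measurable ?M"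
    proof (intro measurable_emeasure_section sets_steiner_open_section)
      show "{z \<in> space (?M \<Otimes>\<^sub>M lborel). snd z \<in> E} \<in> sets (?M \<Otimes>\<^sub>M lborel)"
        using Suc.prems(1) by measurable
    qed measurable
  qed (use prob_space.emeasure_space_1[OF prob_space_uniform_direction[where 'a='a]] in simp_all)
  also have "\<dots> \<le> emeasure lborel (E - ?B)"
    using step[OF Suc.prems] by (simp add: add.commute)
  finally show ?case .
qed simp

section \<open>Almost sure convergence\<close>

lemma ennreal_suminf_finite_tendsto_0:
  fixes f :: "nat \<Rightarrow> ennreal"
  assumes "(\<Sum>n. f n) \<noteq> \<infinity>"
  shows "f \<longlonglongrightarrow> 0"
proof -
  have "f n \<noteq> \<infinity>" for n
    using assms ennreal_suminf_lessD[of f top n] by (simp add: less_top)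
  then have f: "f n = ennreal (enn2real (f n))" for n by (simp add: less_top)
  have "summable (\<lambda>n. enn2real (f n))"
    using assms f by (intro summable_suminf_not_top) auto
  then have "(\<lambda>n. ennreal (enn2real (f n))) \<longlonglongrightarrow> ennreal 0"
    by (intro tendsto_ennrealI summable_LIMSEQ_zero)
  then show ?thesis using f by simp
qed

text \<open>The bound on the expected partial sums does not depend on their length, so the whole
  series has finite expectation and its terms tend to \<open>0\<close> almost surely. No
  monotonicity of the deficits enters.\<close>

lemma AE_deficit_tendsto_0:
  fixes E :: "'a::euclidean_space set"
  assumes r: "0 \<le> r" "r \<le> R" and R: "0 < R"
    and E: "E \<in> sets borel" "E \<subseteq> cball 0 R" "emeasure lborel E = emeasure lborel (cball (0::'a) r)"
  shows "AE U in Pi\<^sub>M UNIV (\<lambda>_. uniform_direction).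
    (\<lambda>n. measure lborel (steiner_open_iter U E n - cball 0 r)) \<longlonglongrightarrow> 0"
proof -
  let ?B = "cball (0::'a) r" and ?M = "Pi\<^sub>M (UNIV :: nat set) (\<lambda>_. uniform_direction :: 'a set measure)"
  obtain c where c: "0 < c" and step: "\<And>E :: 'a set. E \<in> sets borel \<Longrightarrow> E \<subseteq> cball 0 R \<Longrightarrow>
      emeasure lborel E = emeasure lborel ?B \<Longrightarrow>
      (\<integral>\<^sup>+d. emeasure lborel (steiner_open (direction_rep d) E - ?B) \<partial>uniform_direction) +
        ennreal c * (emeasure lborel (E - ?B))\<^sup>2 \<le> emeasure lborel (E - ?B)"
    by (rule expected_deficit[OF R r, where 'a='a]) (rule that)
  let ?f = "\<lambda>n U. ennreal c * (emeasure lborel (steiner_open_iter U E n - ?B))\<^sup>2"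
  note [measurable] = measurable_emeasure_section[OF sets_steiner_open_iter[OF E(1)], of ?B]
  have [measurable]: "?f n \<in> borel_measurable ?M" for n by simp
  have "(\<integral>\<^sup>+U. (\<Sum>n. ?f n U) \<partial>?M) = (\<Sum>n. \<integral>\<^sup>+U. ?f n U \<partial>?M)"
    by (rule nn_integral_suminf) simp
  also have "\<dots> \<le> emeasure lborel (E - ?B)"
  proof (rule suminf_le_const)
    fix n
    have "(\<Sum>k<n. \<integral>\<^sup>+U. ?f k U \<partial>?M) = (\<integral>\<^sup>+U. (\<Sum>k<n. ?f k U) \<partial>?M)"
      by (rule nn_integral_sum[symmetric]) simp
    also have "\<dots> \<le> emeasure lborel (E - ?B)"
      by (rule expected_square_deficit_sum[OF r R step E])
    finally show "(\<Sum>k<n. \<integral>\<^sup>+U. ?f k U \<partial>?M) \<le> emeasure lborel (E - ?B)" .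
  qed simp
  also have "\<dots> < \<infinity>"
    using emeasure_mono[of "E - ?B" E lborel] E emeasure_lborel_cball_finite[of "0::'a" r]
    by (auto simp: less_top intro: le_less_trans)
  finally have "AE U in ?M. (\<Sum>n. ?f n U) \<noteq> \<infinity>"
    by (intro nn_integral_noteq_infinite) auto
  then show ?thesis
  proof eventually_elim
    case (elim U)
    have "(\<lambda>n. ?f n U) \<longlonglongrightarrow> 0" by (rule ennreal_suminf_finite_tendsto_0[OF elim])
    then have "(\<lambda>n. enn2real (?f n U)) \<longlonglongrightarrow> enn2real 0"
      by (intro tendsto_enn2real) auto
    then have "(\<lambda>n. c * (measure lborel (steiner_open_iter U E n - ?B))\<^sup>2) \<longlonglongrightarrow> 0"
      using c by (simp add: enn2real_mult power2_eq_square measure_def)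
    from tendsto_mult[OF tendsto_const[of "1 / c"] this]
    have "(\<lambda>n. (measure lborel (steiner_open_iter U E n - ?B))\<^sup>2) \<longlonglongrightarrow> 0"
      using c by simp
    from tendsto_real_sqrt[OF this] show ?case by simp
  qed
qed

section \<open>Return to the Nikodym distance\<close>

text \<open>Replacing \<open>A\<close> by \<open>E\<close> costs a null set. The factor
  \<open>2\<close> appears because sets of equal finite volume have one-sided differences of equal
  volume.\<close>

lemma nikodym_dist_eq:
  fixes A :: "'a::euclidean_space set"
  assumes E: "E \<in> sets borel" and N: "N \<in> null_sets lborel" and sub: "(A - E) \<union> (E - A) \<subseteq> N"
    and vol: "emeasure lborel E = emeasure lborel (cball (0::'a) r)"
  shows "nikodym_dist A (cball 0 r) = 2 * measure lborel (E - cball 0 r)"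
proof -
  let ?B = "cball (0::'a) r"
  have A: "A \<in> sets lebesgue"
  proof -
    have "A - E \<in> null_sets lebesgue" "E - A \<in> null_sets lebesgue"
      using null_sets_completionI[OF N] sub
      by (auto intro: null_sets_completion_subset)
    moreover have "A = (E - (E - A)) \<union> (A - E)" by auto
    moreover have "E \<in> sets lebesgue" using E by simp
    ultimately show ?thesis by (metis null_setsD2 sets.Diff sets.Un)
  qed
  have "AE x in lebesgue. x \<notin> N" using N by (intro AE_not_in null_sets_completionI)
  then have "emeasure lebesgue ((A - ?B) \<union> (?B - A)) = emeasure lebesgue ((E - ?B) \<union> (?B - E))"
  proof (intro emeasure_eq_AE)
    show "AE x in lebesgue. x \<in> sym_diff A ?B \<longleftrightarrow> x \<in> sym_diff E ?B"
      using \<open>AE x in lebesgue. x \<notin> N\<close> by eventually_elim (use sub in auto)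
    show "sym_diff A ?B \<in> sets lebesgue" "sym_diff E ?B \<in> sets lebesgue"
      using A E by (intro sets.Un sets.Diff; simp)+
  qed
  also have "\<dots> = emeasure lborel ((E - ?B) \<union> (?B - E))" using E by simp
  finally have "nikodym_dist A ?B = measure lborel ((E - ?B) \<union> (?B - E))"
    by (simp add: nikodym_dist_def measure_def)
  also have fin: "?B \<in> fmeasurable lborel" "E \<in> fmeasurable lborel"
    using E vol emeasure_lborel_cball_finite[of "0::'a" r] by (auto simp: fmeasurable_def)
  then have "measure lborel ((E - ?B) \<union> (?B - E)) = measure lborel (E - ?B) + measure lborel (?B - E)"
    by (intro measure_Un_AE) (auto intro: fmeasurable.Diff)
  also have "measure lborel (?B - E) = measure lborel (E - ?B)"
    using emeasure_Diff_eq_Diff[of E lborel ?B] E vol emeasure_lborel_cball_finite[of "0::'a" r]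
    by (simp add: measure_def)
  finally show ?thesis by simp
qed

text \<open>Boundedness makes the volume of \<open>A\<close> finite, so the real-valued
  \<open>measure\<close> in \<open>volume_radius\<close> is the true volume and not the default
  \<open>0\<close>.\<close>

lemma emeasure_cball_volume_radius:
  fixes A :: "'a::euclidean_space set"
  assumes "bounded A" "A \<in> sets lebesgue"
  shows "emeasure lborel (cball (0::'a) (volume_radius A)) = emeasure lebesgue A"
proof -
  have fin: "emeasure lebesgue A = ennreal (measure lebesgue A)"
    using bounded_set_imp_lmeasurable[OF assms] by (simp add: emeasure_eq_measure2 fmeasurableD2)
  have pos: "0 < unit_ball_vol (real DIM('a))" by simp
  then have nz: "unit_ball_vol (real DIM('a)) \<noteq> 0" by (metis less_irrefl)
  have "(volume_radius A) ^ DIM('a) = measure lebesgue A / unit_ball_vol (real DIM('a))"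
    unfolding volume_radius_def using pos by (subst real_root_pow_pos2) (auto simp: content_cball)
  moreover have "0 \<le> volume_radius A"
    unfolding volume_radius_def by (intro real_root_ge_zero) auto
  ultimately show ?thesis
    unfolding fin by (simp add: emeasure_cball nz)
qed

theorem theorem3p5:
  fixes A :: "'a::euclidean_space set"
  assumes "bounded A" and "A \<in> sets lebesgue"
  shows "AE U in Pi\<^sub>M (UNIV :: nat set) (\<lambda>_. uniform_direction).
           (\<lambda>n. nikodym_dist (steiner_iter U A n) (cball 0 (volume_radius A))) \<longlonglongrightarrow> 0"
proof -
  let ?M = "Pi\<^sub>M (UNIV :: nat set) (\<lambda>_. uniform_direction :: 'a set measure)"
  define r where "r = volume_radius A"
  have r: "0 \<le> r" unfolding r_def volume_radius_def by (intro real_root_ge_zero) auto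
  \<comment> \<open>Measurability in the completion provides a Borel set inside \<open>A\<close>
    that misses only part of a Borel null set.\<close>
  obtain E N N' where A: "A = E \<union> N'" "N' \<subseteq> N" and N: "N \<in> null_sets lborel" and E: "E \<in> sets borel"
    using sets_completionE[OF assms(2)] by (metis sets_lborel)
  have sub: "(A - E) \<union> (E - A) \<subseteq> N" and "E \<subseteq> A" using A by auto
  obtain a where a: "A \<subseteq> cball 0 a" using assms(1) by (auto simp: bounded_iff subset_iff)
  \<comment> \<open>One radius for both \<open>A\<close> and the ball of radius \<open>r\<close>;
    the \<open>1\<close> keeps it positive when \<open>A\<close> is null or empty.\<close>
  define R where "R = max 1 (max a r)"
  have R: "0 < R" "r \<le> R" "a \<le> R" by (auto simp: R_def)
  have ER: "E \<subseteq> cball 0 R"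
    using \<open>E \<subseteq> A\<close> a subset_cball[OF R(3), of 0] by blast
  have "emeasure lebesgue A = emeasure lebesgue E"
  proof (rule emeasure_eq_AE)
    show "AE x in lebesgue. (x \<in> A) = (x \<in> E)"
      using AE_not_in[OF null_sets_completionI[OF N]] by eventually_elim (use sub in auto)
  qed (use assms E in auto)
  then have vol: "emeasure lborel E = emeasure lborel (cball (0::'a) r)"
    using emeasure_cball_volume_radius[OF assms] E by (simp add: r_def)
  \<comment> \<open>There are countably many directions, so almost surely none of them has a
    representative outside its class.\<close>
  have "AE U in ?M. \<forall>n. direction_rep (U n) \<in> U n"
    unfolding AE_all_countable
    by (intro allI AE_PiM_component AE_direction_rep_mem) (auto simp: prob_space_uniform_direction)
  moreover have "AE U in ?M. U \<in> space ?M" by (rule AE_space)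
  moreover have "AE U in ?M. (\<lambda>n. measure lborel (steiner_open_iter U E n - cball 0 r)) \<longlonglongrightarrow> 0"
    by (rule AE_deficit_tendsto_0[OF r R(2,1) E ER vol])
  ultimately show ?thesis
  proof eventually_elim
    case (elim U)
    then have U: "U n \<in> sphere 0 1 // antipodal" "direction_rep (U n) \<in> U n" for n
      by (auto simp: space_PiM)
    have "nikodym_dist (steiner_iter U A n) (cball 0 r) =
        2 * measure lborel (steiner_open_iter U E n - cball 0 r)" for n
      using steiner_iter_null_diff[where U=U and n=n, OF U E N sub]
        steiner_open_iter_invariants[where U=U and n=n, OF U(1) _ E ER] R vol
      by (auto intro: nikodym_dist_eq)
    then show ?case
      using tendsto_mult[OF tendsto_const[of 2] elim(3)] by (simp add: r_def)
  qed
qed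

end
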